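(* Let $f:\mathbb{CP}^1\to\mathbb{CP}^1$ be a rational function. Then for any good orbifold $\mathcal O$ on $\mathbb{CP}^1$ the orbifold $f^*(\mathcal O)$ is good.
   Context: Rational functions are non-constant, viewed as holomorphic maps $\mathbb{CP}^1\to\mathbb{CP}^1$; $\deg_z f$ denotes the local degree (multiplicity) of $f$ at $z$. An orbifold $\mathcal O=(R,\nu)$ is a Riemann surface $R$ with a ramification function $\nu:R\to\mathbb N=\{1,2,\dots\}$ equal to $1$ except at isolated points. $\mathcal O$ is bad if $R=\mathbb{CP}^1$ and either exactly one point has $\nu>1$, or exactly two points $z_1,z_2$ have $\nu>1$ and $\nu(z_1)\ne\nu(z_2)$; otherwise it is good. For a holomorphic map $f:R'\to R$ between compact Riemann surfaces and an orbifold $\mathcal O=(R,\nu)$, the orbifold $f^*(\mathcal O)=(R',\nu')$ is defined by $\nu'(z)=\nu(f(z))/\gcd(\deg_z f,\nu(f(z)))$ for $z\in R'$. *)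

theory Defs
  imports
    "HOL-Complex_Analysis.Complex_Analysis"
    "HOL-Computational_Algebra.Computational_Algebra"
begin

section \<open>The Riemann sphere\<close>

datatype cp1 = Fin complex | Infty

text \<open>The topology is that of the one-point compactification of the complex plane.\<close>

instantiation cp1 :: topological_space
begin

definition open_cp1 :: "cp1 set \<Rightarrow> bool" where
  "open_cp1 U \<longleftrightarrow> open (Fin -` U) \<and> (Infty \<in> U \<longrightarrow> compact (- (Fin -` U)))"

instance
proof
  show "open (UNIV :: cp1 set)"
    by (simp add: open_cp1_def)
next
  fix S T :: "cp1 set"
  assume "open S" and "open T"
  then show "open (S \<inter> T)"
    by (auto simp: open_cp1_def Compl_Int intro!: open_Int compact_Un)
next
  fix K :: "cp1 set set"
  assume K: "\<forall>S\<in>K. open S"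
  have *: "open (Fin -` \<Union>K)"
    unfolding vimage_Union using K by (auto simp: open_cp1_def)
  moreover have "compact (- (Fin -` \<Union>K))" if "Infty \<in> \<Union>K"
  proof -
    obtain S where S: "S \<in> K" "Infty \<in> S"
      using \<open>Infty \<in> \<Union>K\<close> by blast
    then have "compact (- (Fin -` S))"
      using K by (auto simp: open_cp1_def)
    moreover have "closed (- (Fin -` \<Union>K))"
      using * by (simp add: closed_def)
    ultimately have "compact (- (Fin -` S) \<inter> - (Fin -` \<Union>K))"
      by (rule compact_Int_closed)
    moreover have "- (Fin -` S) \<inter> - (Fin -` \<Union>K) = - (Fin -` \<Union>K)"
      using S by auto
    ultimately show ?thesis by simp
  qed
  ultimately show "open (\<Union>K)"
    by (auto simp: open_cp1_def)
qed

end

section \<open>Rational functions and local degrees\<close>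

text \<open>The self-map of the sphere given by \<open>p / q\<close>, for coprime \<open>p\<close> and \<open>q\<close> with \<open>q\<close> nonzero.
  The value at infinity is the limit of \<open>p w / q w\<close> as \<open>w\<close> tends to infinity; the finite case also
  covers \<open>degree p < degree q\<close>, where the coefficient in the numerator is \<open>0\<close>.\<close>

definition ratio_map :: "complex poly \<Rightarrow> complex poly \<Rightarrow> cp1 \<Rightarrow> cp1" where
  "ratio_map p q z =
     (case z of
        Fin w \<Rightarrow> if poly q w = 0 then Infty else Fin (poly p w / poly q w)
      | Infty \<Rightarrow> if degree q < degree p then Infty
                 else Fin (coeff p (degree q) / lead_coeff q))"

definition rational_function :: "(cp1 \<Rightarrow> cp1) \<Rightarrow> bool" where
  "rational_function f \<longleftrightarrow>
     (\<exists>p q. q \<noteq> 0 \<and> coprime p q \<and> f = ratio_map p q) \<and> \<not> f constant_on UNIV"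

text \<open>A local parametrization of the sphere that sends \<open>0\<close> to the given point, and a local
  coordinate that vanishes at the given point. The coordinate is only meaningful near that point;
  elsewhere (at infinity, respectively at \<open>Fin 0\<close>) it takes a dummy value.\<close>

fun param_at :: "cp1 \<Rightarrow> complex \<Rightarrow> cp1" where
  "param_at (Fin a) w = Fin (a + w)"
| "param_at Infty w = (if w = 0 then Infty else Fin (1 / w))"

fun coord_at :: "cp1 \<Rightarrow> cp1 \<Rightarrow> complex" where
  "coord_at (Fin b) (Fin u) = u - b"
| "coord_at (Fin b) Infty = 0"
| "coord_at Infty (Fin u) = 1 / u"
| "coord_at Infty Infty = 0"

definition local_degree :: "(cp1 \<Rightarrow> cp1) \<Rightarrow> cp1 \<Rightarrow> nat" where
  "local_degree f z = nat (zorder (\<lambda>w. coord_at (f z) (f (param_at z w))) 0)"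

section \<open>Orbifolds on the sphere\<close>

text \<open>The underlying surface is always the sphere, so an orbifold is given by its ramification
  function. The points where it differs from \<open>1\<close> form a closed discrete set.\<close>

definition orbifold :: "(cp1 \<Rightarrow> nat) \<Rightarrow> bool" where
  "orbifold \<nu> \<longleftrightarrow> (\<forall>z. \<nu> z \<ge> 1) \<and> {z. \<nu> z \<noteq> 1} sparse_in UNIV"

definition bad :: "(cp1 \<Rightarrow> nat) \<Rightarrow> bool" where
  "bad \<nu> \<longleftrightarrow>
     (\<exists>z. {x. \<nu> x > 1} = {z}) \<or>
     (\<exists>z1 z2. z1 \<noteq> z2 \<and> {x. \<nu> x > 1} = {z1, z2} \<and> \<nu> z1 \<noteq> \<nu> z2)"

definition good_orbifold :: "(cp1 \<Rightarrow> nat) \<Rightarrow> bool" where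
  "good_orbifold \<nu> \<longleftrightarrow> orbifold \<nu> \<and> \<not> bad \<nu>"

definition pullback :: "(cp1 \<Rightarrow> cp1) \<Rightarrow> (cp1 \<Rightarrow> nat) \<Rightarrow> cp1 \<Rightarrow> nat" where
  "pullback f \<nu> z = \<nu> (f z) div gcd (local_degree f z) (\<nu> (f z))"

end

(* If the pullback is bad, there are points z1, z2 with weights a, b such that b does not divide a and
   all other weights are 1. Precomposing f with w^a in a coordinate sending z1, z2 to 0, infinity makes
   all weights 1 except possibly the one at infinity. Writing f = p / q, every member of the pencil
   spanned by p and q is then a power, with exponent the value of the orbifold function, and it
   remains to show that these exponents divide N = deg f. Otherwise three orbifold points give
   coprime polynomials with x^a + y^b = z^c where c does not divide N. By Mason-Stothers
   1/a + 1/b + 1/c > 1, so the triple is spherical. The solvable cases follow by factoring. In the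
   icosahedral case an explicit quintic has locally only holomorphic roots, hence, the plane being
   simply connected, an entire root; it has polynomial growth, so it is a polynomial, and it reduces
   the equation to the tetrahedral case. *)
theory Submission
  imports Defs "HOL-Computational_Algebra.Field_as_Ring"
begin

section \<open>Continuation of holomorphic solutions of an implicit equation\<close>

text \<open>Goodness of the target is used at a single place. If \<open>\<nu> c\<close> does not
  divide N, the member over \<open>c\<close> has degree below N, since its degree is a multiple of
  \<open>\<nu> c\<close>; all other members then have degree N. A second weighted point exists, its
  weight divides N and so differs from \<open>\<nu> c\<close>, and only a third weighted point keeps
  the orbifold from being bad. The linear relation between the three members is the equation between
  powers. The obstacle is the triple 2, 3, 5. The groups of the other spherical triples are
  solvable, which shows in repeated factoring into coprime powers. The icosahedral group A5 is
  simple and offers no such start, but its subgroup A4 has index 5; a root of a quintic resolvent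
  therefore leaves a tetrahedral problem. The quintic has multiple roots at some points although its
  solutions do not ramify there. Hence no discriminant condition is available, and continuation is
  phrased for whole solutions, which may cross each other.\<close>

definition continuable :: "(complex \<Rightarrow> complex \<Rightarrow> complex) \<Rightarrow> complex set \<Rightarrow> bool" where
  "continuable P U \<longleftrightarrow>
     (\<forall>A \<sigma>. open A \<and> connected A \<and> A \<noteq> {} \<and> A \<subseteq> U \<and> \<sigma> holomorphic_on A \<and> (\<forall>t\<in>A. P t (\<sigma> t) = 0)
        \<longrightarrow> (\<exists>\<tau>. \<tau> holomorphic_on U \<and> (\<forall>t\<in>U. P t (\<tau> t) = 0) \<and> (\<forall>t\<in>A. \<tau> t = \<sigma> t)))"

lemma continuableE:
  assumes "continuable P U" "open A" "connected A" "A \<noteq> {}" "A \<subseteq> U" "\<sigma> holomorphic_on A"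
    "\<And>t. t \<in> A \<Longrightarrow> P t (\<sigma> t) = 0"
  obtains \<tau> where "\<tau> holomorphic_on U" "\<And>t. t \<in> U \<Longrightarrow> P t (\<tau> t) = 0" "\<And>t. t \<in> A \<Longrightarrow> \<tau> t = \<sigma> t"
  using assms unfolding continuable_def by metis

lemma continuable_subset:
  assumes "continuable P U" "V \<subseteq> U"
  shows "continuable P V"
  unfolding continuable_def
proof (intro allI impI, elim conjE)
  fix A \<sigma>
  assume A: "open A" "connected A" "A \<noteq> {}" "A \<subseteq> V" "\<sigma> holomorphic_on A" "\<forall>t\<in>A. P t (\<sigma> t) = 0"
  then obtain \<tau> where "\<tau> holomorphic_on U" "\<And>t. t \<in> U \<Longrightarrow> P t (\<tau> t) = 0" "\<And>t. t \<in> A \<Longrightarrow> \<tau> t = \<sigma> t"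
    using continuableE[OF assms(1), of A \<sigma>] assms(2) by (metis subset_trans)
  then show "\<exists>\<tau>. \<tau> holomorphic_on V \<and> (\<forall>t\<in>V. P t (\<tau> t) = 0) \<and> (\<forall>t\<in>A. \<tau> t = \<sigma> t)"
    using assms(2) holomorphic_on_subset by blast
qed

text \<open>A solution is extended from a small disc to the first set, then from the overlap to the
  second; the overlap has to be connected to serve as a starting domain. Since
  \<open>continuable\<close> allows every connected starting domain, the identity theorem recovers
  agreement on the original one, which may stretch over both sets.\<close>

lemma continuable_Un:
  assumes U: "open U" "continuable P U" and V: "open V" "continuable P V"
    and UV: "connected (U \<inter> V)" "U \<inter> V \<noteq> {}"
  shows "continuable P (U \<union> V)"
proof -
  \<comment> \<open>Stated for variable sets because the disc to start from may lie in either of the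
    two.\<close>
  have *: "\<exists>\<tau>. \<tau> holomorphic_on (U' \<union> V') \<and> (\<forall>t\<in>U' \<union> V'. P t (\<tau> t) = 0) \<and> (\<forall>t\<in>A. \<tau> t = \<sigma> t)"
    if UV': "open U'" "continuable P U'" "open V'" "continuable P V'" "connected (U' \<inter> V')" "U' \<inter> V' \<noteq> {}"
      and A: "open A" "connected A" "A \<subseteq> U' \<union> V'" "\<sigma> holomorphic_on A" "\<forall>t\<in>A. P t (\<sigma> t) = 0"
      and a: "a \<in> A" "a \<in> U'" for U' V' A \<sigma> a
  proof -
    have "open (A \<inter> U')" using A UV' by blast
    then obtain e where e: "e > 0" "ball a e \<subseteq> A \<inter> U'"
      using a open_contains_ball by (metis IntI)
    obtain \<tau>1 where t1: "\<tau>1 holomorphic_on U'" "\<And>t. t \<in> U' \<Longrightarrow> P t (\<tau>1 t) = 0"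
        "\<And>t. t \<in> ball a e \<Longrightarrow> \<tau>1 t = \<sigma> t"
    proof (rule continuableE[OF UV'(2), of "ball a e" \<sigma>])
      show "\<sigma> holomorphic_on ball a e" using A(4) e holomorphic_on_subset by blast
    qed (use A e in auto)
    obtain \<tau>2 where t2: "\<tau>2 holomorphic_on V'" "\<And>t. t \<in> V' \<Longrightarrow> P t (\<tau>2 t) = 0"
        "\<And>t. t \<in> U' \<inter> V' \<Longrightarrow> \<tau>2 t = \<tau>1 t"
    proof (rule continuableE[OF UV'(4), of "U' \<inter> V'" \<tau>1])
      show "\<tau>1 holomorphic_on U' \<inter> V'" using t1(1) holomorphic_on_subset by blast
    qed (use UV' t1 in auto)
    define \<tau> where "\<tau> = (\<lambda>z. if z \<in> U' then \<tau>1 z else \<tau>2 z)"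
    have hol: "\<tau> holomorphic_on (U' \<union> V')"
      unfolding \<tau>_def using t1 t2 UV' by (intro holomorphic_on_If_Un) auto
    moreover have "\<tau> t = \<sigma> t" if "t \<in> A" for t
    proof (rule analytic_continuation_open[of "ball a e" A \<tau> \<sigma>])
      show "\<tau> holomorphic_on A" using hol A(3) holomorphic_on_subset by blast
      show "\<And>z. z \<in> ball a e \<Longrightarrow> \<tau> z = \<sigma> z" using t1(3) e by (auto simp: \<tau>_def)
    qed (use A e that in auto)
    ultimately show ?thesis using t1(2) t2(2) by (intro exI[of _ \<tau>]) (auto simp: \<tau>_def)
  qed
  show ?thesis
    unfolding continuable_def
  proof (intro allI impI, elim conjE)
    fix A \<sigma>
    assume A: "open A" "connected A" "A \<noteq> {}" "A \<subseteq> U \<union> V" "\<sigma> holomorphic_on A" "\<forall>t\<in>A. P t (\<sigma> t) = 0"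
    then obtain a where "a \<in> A" "a \<in> U \<or> a \<in> V" by blast
    then show "\<exists>\<tau>. \<tau> holomorphic_on U \<union> V \<and> (\<forall>t\<in>U \<union> V. P t (\<tau> t) = 0) \<and> (\<forall>t\<in>A. \<tau> t = \<sigma> t)"
      using *[of U V A \<sigma> a] *[of V U A \<sigma> a] A assms
      by (auto simp: Un_commute Int_commute)
  qed
qed

text \<open>A window of width \<open>2 * d\<close> advances by \<open>d\<close>, so each new window
  meets the box built so far in a convex, hence connected, strip of width \<open>d\<close>.\<close>

lemma continuable_box_horizontal:
  fixes P :: "complex \<Rightarrow> complex \<Rightarrow> complex"
  assumes "d > 0" "n \<ge> 1"
    and "\<And>x. x \<in> {a..a + real n * d} \<Longrightarrow> continuable P (box (Complex x c) (Complex (x + 2 * d) e))" "c < e"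
  shows "continuable P (box (Complex a c) (Complex (a + real n * d) e))"
  using assms(2,3)
proof (induction n rule: dec_induct)
  case base
  then show ?case
    using assms(1) by (intro continuable_subset[OF base[of a]]) (auto simp: in_box_complex_iff)
next
  case (step n)
  define m where "m = real n * d"
  define U where "U = box (Complex a c) (Complex (a + m) e)"
  define V where "V = box (Complex (a + m - d) c) (Complex (a + m + d) e)"
  have S: "real (Suc n) * d = m + d" by (simp add: m_def algebra_simps)
  have n: "m \<ge> d" using step(1) assms(1) by (simp add: m_def)
  have sub: "{a..a + m} \<subseteq> {a..a + real (Suc n) * d}"
    using assms(1) by (auto simp: m_def algebra_simps)
  have U: "continuable P U"
    using step.IH step.prems sub unfolding U_def m_def by (meson subsetD)
  have V: "continuable P V"
    using step.prems[of "a + m - d"] n assms(1) by (simp add: V_def m_def algebra_simps)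
  have op: "open U" "open V" by (simp_all add: U_def V_def open_box)
  have UV: "U \<inter> V = box (Complex (a + m - d) c) (Complex (a + m) e)"
    using n assms(1) by (auto simp: U_def V_def in_box_complex_iff)
  have con: "connected (U \<inter> V)" unfolding UV by (intro convex_connected convex_box)
  have "Complex (a + m - d / 2) ((c + e) / 2) \<in> U \<inter> V"
    using assms by (auto simp: UV in_box_complex_iff field_simps)
  then have "continuable P (U \<union> V)"
    using U V op con by (intro continuable_Un) auto
  moreover have "U \<union> V = box (Complex a c) (Complex (a + real (Suc n) * d) e)"
    using n assms(1) unfolding S by (auto simp: U_def V_def in_box_complex_iff)
  ultimately show ?case by simp
qed

lemma continuable_box_vertical:
  fixes P :: "complex \<Rightarrow> complex \<Rightarrow> complex"
  assumes "d > 0" "n \<ge> 1"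
    and "\<And>x. x \<in> {a..a + real n * d} \<Longrightarrow> continuable P (box (Complex c x) (Complex e (x + 2 * d)))" "c < e"
  shows "continuable P (box (Complex c a) (Complex e (a + real n * d)))"
  using assms(2,3)
proof (induction n rule: dec_induct)
  case base
  then show ?case
    using assms(1) by (intro continuable_subset[OF base[of a]]) (auto simp: in_box_complex_iff)
next
  case (step n)
  define m where "m = real n * d"
  define U where "U = box (Complex c a) (Complex e (a + m))"
  define V where "V = box (Complex c (a + m - d)) (Complex e (a + m + d))"
  have S: "real (Suc n) * d = m + d" by (simp add: m_def algebra_simps)
  have n: "m \<ge> d" using step(1) assms(1) by (simp add: m_def)
  have sub: "{a..a + m} \<subseteq> {a..a + real (Suc n) * d}"
    using assms(1) by (auto simp: m_def algebra_simps)
  have U: "continuable P U"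
    using step.IH step.prems sub unfolding U_def m_def by (meson subsetD)
  have V: "continuable P V"
    using step.prems[of "a + m - d"] n assms(1) by (simp add: V_def m_def algebra_simps)
  have op: "open U" "open V" by (simp_all add: U_def V_def open_box)
  have UV: "U \<inter> V = box (Complex c (a + m - d)) (Complex e (a + m))"
    using n assms(1) by (auto simp: U_def V_def in_box_complex_iff)
  have con: "connected (U \<inter> V)" unfolding UV by (intro convex_connected convex_box)
  have "Complex ((c + e) / 2) (a + m - d / 2) \<in> U \<inter> V"
    using assms by (auto simp: UV in_box_complex_iff field_simps)
  then have "continuable P (U \<union> V)"
    using U V op con by (intro continuable_Un) auto
  moreover have "U \<union> V = box (Complex c a) (Complex e (a + real (Suc n) * d))"
    using n assms(1) unfolding S by (auto simp: U_def V_def in_box_complex_iff)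
  ultimately show ?case by simp
qed

text \<open>A Lebesgue number for the cover by good discs gives a mesh size; small squares are glued
  to rows, and rows to the full square.\<close>

lemma continuable_square:
  fixes P :: "complex \<Rightarrow> complex \<Rightarrow> complex"
  assumes loc: "\<And>t. \<exists>e>0. continuable P (ball t e)" and R: "R > 0"
  shows "continuable P (box (Complex (-R) (-R)) (Complex R R))"
proof -
  define K :: "complex set" where "K = cball 0 (8 * R)"
  obtain r where r: "\<And>t. r t > 0" "\<And>t. continuable P (ball t (r t))" using loc by metis
  have "compact K" by (simp add: K_def)
  have "K \<subseteq> \<Union>((\<lambda>t. ball t (r t)) ` UNIV)" using r(1) centre_in_ball by blast
  then obtain \<delta> where \<delta>: "\<delta> > 0" "\<And>x. x \<in> K \<Longrightarrow> \<exists>G\<in>(\<lambda>t. ball t (r t)) ` UNIV. ball x \<delta> \<subseteq> G"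
    by (rule Heine_Borel_lemma[OF \<open>compact K\<close>, of "(\<lambda>t. ball t (r t)) ` UNIV"]) auto
  obtain n :: nat where n: "n \<ge> 1" "real n > 8 * R / \<delta>"
  proof -
    obtain n where "real n > 8 * R / \<delta>" using reals_Archimedean2 by blast
    then show ?thesis using that[of "Suc n"] by simp
  qed
  \<comment> \<open>With \<open>4 * d < \<delta>\<close>, a square of side \<open>2 * d\<close> lies
    within distance \<open>\<delta>\<close> of its lower left corner, the distance being estimated
    by the sum of the coordinate differences.\<close>
  define d where "d = 2 * R / real n"
  have d: "d > 0" "4 * d < \<delta>" "real n * d = 2 * R"
    using n R \<delta>(1) by (auto simp: d_def field_simps)
  have dR: "d \<le> 2 * R" using n R by (auto simp: d_def field_simps)
  have small: "continuable P (box (Complex x y) (Complex (x + 2 * d) (y + 2 * d)))"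
    if xy: "x \<in> {-R..R}" "y \<in> {-R..R}" for x y
  proof -
    have "norm (Complex x y) \<le> \<bar>x\<bar> + \<bar>y\<bar>" using cmod_le[of "Complex x y"] by simp
    then have "Complex x y \<in> K" using xy R by (auto simp: K_def)
    then obtain t where t: "ball (Complex x y) \<delta> \<subseteq> ball t (r t)" using \<delta>(2) by blast
    have "box (Complex x y) (Complex (x + 2 * d) (y + 2 * d)) \<subseteq> ball (Complex x y) \<delta>"
    proof
      fix z assume z: "z \<in> box (Complex x y) (Complex (x + 2 * d) (y + 2 * d))"
      have "dist (Complex x y) z \<le> \<bar>Re z - x\<bar> + \<bar>Im z - y\<bar>"
        using cmod_le[of "z - Complex x y"] by (simp add: dist_norm norm_minus_commute)
      also have "\<dots> < \<delta>" using z d(2) by (auto simp: in_box_complex_iff)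
      finally show "z \<in> ball (Complex x y) \<delta>" by simp
    qed
    then show ?thesis using continuable_subset[OF r(2)] t by (meson subset_trans)
  qed
  have "continuable P (box (Complex (-R) y) (Complex R (y + 2 * d)))" if y: "y \<in> {-R..R}" for y
    using continuable_box_horizontal[OF d(1) n(1), of "-R" P y "y + 2 * d"] small[OF _ y] d(1,3) by auto
  then show ?thesis
    using continuable_box_vertical[OF d(1) n(1), of "-R" P "-R" R] d(3) R by auto
qed

text \<open>The plane is exhausted by nested squares that all contain one disc of the starting
  domain. Extensions from this disc are unique on each square, so they fit together.\<close>

lemma continuable_UNIV:
  fixes P :: "complex \<Rightarrow> complex \<Rightarrow> complex"
  assumes loc: "\<And>t. \<exists>e>0. continuable P (ball t e)"
  shows "continuable P UNIV"
  unfolding continuable_def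
proof (intro allI impI, elim conjE)
  fix A \<sigma>
  assume A: "open A" "connected A" "A \<noteq> {}" "A \<subseteq> UNIV" "\<sigma> holomorphic_on A" "\<forall>t\<in>A. P t (\<sigma> t) = 0"
  then obtain a e where a: "a \<in> A" "e > 0" "ball a e \<subseteq> A"
    by (metis all_not_in_conv open_contains_ball)
  define R where "R n = norm a + e + real n" for n
  define S where "S n = box (Complex (-R n) (-R n)) (Complex (R n) (R n))" for n
  have Rpos: "R n > 0" for n using a(2) norm_ge_zero[of a] unfolding R_def by linarith
  have inS: "z \<in> S n" if "norm z < R n" for z n
    using that abs_Re_le_cmod[of z] abs_Im_le_cmod[of z] by (auto simp: S_def in_box_complex_iff)
  have ball: "ball a e \<subseteq> S n" for n
  proof
    fix z assume "z \<in> ball a e"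
    then have "norm z < norm a + e"
      using norm_triangle_ineq[of a "z - a"] by (auto simp: dist_norm norm_minus_commute)
    then show "z \<in> S n" by (intro inS) (simp add: R_def)
  qed
  have "\<exists>\<tau>. \<tau> holomorphic_on S n \<and> (\<forall>t\<in>S n. P t (\<tau> t) = 0) \<and> (\<forall>t\<in>ball a e. \<tau> t = \<sigma> t)" for n
  proof -
    have hol: "\<sigma> holomorphic_on ball a e" using A(5) a holomorphic_on_subset by blast
    obtain \<tau> where "\<tau> holomorphic_on S n" "\<And>t. t \<in> S n \<Longrightarrow> P t (\<tau> t) = 0" "\<And>t. t \<in> ball a e \<Longrightarrow> \<tau> t = \<sigma> t"
    proof (rule continuableE[OF continuable_square[OF loc Rpos[of n], folded S_def], of "ball a e" \<sigma>])
      show "\<And>t. t \<in> ball a e \<Longrightarrow> P t (\<sigma> t) = 0" using A(6) a by blast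
    qed (use ball[of n] a hol in auto)
    then show ?thesis by blast
  qed
  then obtain T where T: "\<And>n. T n holomorphic_on S n" "\<And>n t. t \<in> S n \<Longrightarrow> P t (T n t) = 0"
    "\<And>n t. t \<in> ball a e \<Longrightarrow> T n t = \<sigma> t" by metis
  have mono: "S m \<subseteq> S n" if "m \<le> n" for m n using that by (auto simp: S_def R_def in_box_complex_iff)
  have opS: "open (S n)" "connected (S n)" for n
    by (auto simp: S_def convex_connected convex_box)
  have agree: "T n t = T m t" if "m \<le> n" "t \<in> S m" for m n t
  proof (rule analytic_continuation_open[of "ball a e" "S m" "T n" "T m"])
    show "T n holomorphic_on S m" using T(1) mono[OF that(1)] holomorphic_on_subset by blast
  qed (use T ball opS that a in auto)
  define N where "N t = (LEAST n. t \<in> S n)" for t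
  have N: "t \<in> S (N t)" for t
  proof -
    obtain n where "real n > norm t" using reals_Archimedean2 by blast
    then have "norm t < R n" using a(2) norm_ge_zero[of a] unfolding R_def by linarith
    then have "t \<in> S n" by (rule inS)
    then show ?thesis unfolding N_def by (rule LeastI)
  qed
  define \<tau> where "\<tau> t = T (N t) t" for t
  have \<tau>: "\<tau> t = T n t" if "t \<in> S n" for t n
  proof -
    have "N t \<le> n" unfolding N_def using that by (rule Least_le)
    then show ?thesis using agree N by (metis \<tau>_def)
  qed
  have "\<tau> holomorphic_on UNIV"
    unfolding holomorphic_on_def
  proof
    fix t :: complex
    have "T (N t) field_differentiable at t"
      using T(1)[of "N t"] opS(1) N[of t] by (metis at_within_open holomorphic_on_def)
    moreover have "eventually (\<lambda>u. \<tau> u = T (N t) u) (nhds t)"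
      using opS(1)[of "N t"] N[of t] \<tau> by (intro eventually_nhds[THEN iffD2]) blast
    ultimately show "\<tau> field_differentiable at t"
      by (auto simp: field_differentiable_def cong: DERIV_cong_ev)
  qed
  moreover have "P t (\<tau> t) = 0" for t using T(2) N by (simp add: \<tau>_def)
  moreover have "\<tau> t = \<sigma> t" if "t \<in> A" for t
  proof (rule analytic_continuation_open[of "ball a e" A \<tau> \<sigma>])
    show "\<tau> holomorphic_on A" using calculation(1) holomorphic_on_subset by blast
    show "\<And>z. z \<in> ball a e \<Longrightarrow> \<tau> z = \<sigma> z" using \<tau>[of _ 0] ball[of 0] T(3) by auto
  qed (use A a that in auto)
  ultimately show "\<exists>\<tau>. \<tau> holomorphic_on UNIV \<and> (\<forall>t\<in>UNIV. P t (\<tau> t) = 0) \<and> (\<forall>t\<in>A. \<tau> t = \<sigma> t)"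
    by blast
qed

text \<open>Holomorphic functions on a connected domain have no zero divisors: where one factor is
  nonzero, an open set, the product of the others vanishes, and the identity theorem spreads this to
  the whole domain.\<close>

lemma holomorphic_prod_eq_zero:
  assumes "finite F" "open A" "connected A" "A \<noteq> {}"
    and "\<And>f. f \<in> F \<Longrightarrow> g f holomorphic_on A" and "\<And>t. t \<in> A \<Longrightarrow> (\<Prod>f\<in>F. g f t) = (0 :: complex)"
  shows "\<exists>f\<in>F. \<forall>t\<in>A. g f t = 0"
  using assms(1,5,6)
proof (induction F rule: finite_induct)
  case empty
  then show ?case using assms(4) by auto
next
  case (insert f F)
  show ?case
  proof (cases "\<forall>t\<in>A. g f t = 0")
    case False
    then obtain a where a: "a \<in> A" "g f a \<noteq> 0" by blast
    have "continuous_on A (g f)" using insert by (simp add: holomorphic_on_imp_continuous_on)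
    then have B: "open {t \<in> A. g f t \<noteq> 0}"
      using assms(2) continuous_open_preimage[of A "g f" "-{0}"]
      by (simp add: vimage_def Int_def open_Compl)
    have "(\<Prod>f\<in>F. g f t) = 0" if "t \<in> A" for t
    proof (rule analytic_continuation_open[of "{t \<in> A. g f t \<noteq> 0}" A "\<lambda>t. \<Prod>f\<in>F. g f t" "\<lambda>_. 0"])
      show "(\<lambda>t. \<Prod>f\<in>F. g f t) holomorphic_on A" using insert by (intro holomorphic_intros) auto
      show "\<And>z. z \<in> {t \<in> A. g f t \<noteq> 0} \<Longrightarrow> (\<Prod>f\<in>F. g f z) = 0" using insert by auto
    qed (use B a assms that in auto)
    then show ?thesis using insert by auto
  qed auto
qed

text \<open>A solution takes at each point the value of some branch, but the branch could vary with
  the point, as branches may cross. The product of all differences vanishes identically, so one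
  difference does.\<close>

lemma continuable_finite:
  assumes "finite F" "\<And>f. f \<in> F \<Longrightarrow> f holomorphic_on U" "\<And>f t. f \<in> F \<Longrightarrow> t \<in> U \<Longrightarrow> P t (f t) = 0"
    and "\<And>t X. t \<in> U \<Longrightarrow> P t X = 0 \<Longrightarrow> \<exists>f\<in>F. X = f t"
  shows "continuable P U"
  unfolding continuable_def
proof (intro allI impI, elim conjE)
  fix A \<sigma>
  assume A: "open A" "connected A" "A \<noteq> {}" "A \<subseteq> U" "\<sigma> holomorphic_on A" "\<forall>t\<in>A. P t (\<sigma> t) = 0"
  have "\<exists>f\<in>F. \<forall>t\<in>A. f t - \<sigma> t = 0"
  proof (rule holomorphic_prod_eq_zero)
    show "(\<lambda>t. f t - \<sigma> t) holomorphic_on A" if "f \<in> F" for f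
      using that A assms(2) holomorphic_on_subset by (intro holomorphic_intros) blast+
    fix t assume t: "t \<in> A"
    then obtain f where "f \<in> F" "\<sigma> t = f t" using A assms(4) by blast
    then show "(\<Prod>f\<in>F. f t - \<sigma> t) = 0" using assms(1) by (auto simp: prod_zero_iff)
  qed (use A assms in auto)
  then show "\<exists>\<tau>. \<tau> holomorphic_on U \<and> (\<forall>t\<in>U. P t (\<tau> t) = 0) \<and> (\<forall>t\<in>A. \<tau> t = \<sigma> t)"
    using assms by (metis eq_iff_diff_eq_0)
qed

section \<open>Polynomial roots of the icosahedral quintic\<close>

text \<open>The branches are known only near each root over \<open>t0\<close>, with a radius
  depending on the root. Compactness of the root set leaves finitely many neighbourhoods, and the
  uniform bound keeps roots over nearby points from escaping them.\<close>

lemma continuable_ball_of_local_roots: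
  fixes P :: "complex \<Rightarrow> complex \<Rightarrow> complex"
  assumes cont: "continuous_on UNIV (\<lambda>(t, X). P t X)"
    and bd: "\<And>t X. t \<in> cball t0 1 \<Longrightarrow> P t X = 0 \<Longrightarrow> norm X \<le> R"
    and loc: "\<And>X0. P t0 X0 = 0 \<Longrightarrow> \<exists>N e F. open N \<and> X0 \<in> N \<and> e > 0 \<and> finite F \<and>
       (\<forall>f\<in>F. f holomorphic_on ball t0 e \<and> (\<forall>t\<in>ball t0 e. P t (f t) = 0)) \<and>
       (\<forall>t\<in>ball t0 e. \<forall>X\<in>N. P t X = 0 \<longrightarrow> (\<exists>f\<in>F. X = f t))"
  shows "\<exists>e>0. continuable P (ball t0 e)"
proof -
  define Z where "Z = {X. P t0 X = 0}"
  have closed_roots: "closed {p. (\<lambda>(t, X). P t X) p = 0}"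
    using continuous_closed_preimage_constant[OF cont closed_UNIV, of 0] by simp
  have "Z = (\<lambda>X. (t0, X)) -` {p. (\<lambda>(t, X). P t X) p = 0}" by (auto simp: Z_def)
  moreover have "closed ((\<lambda>X. (t0, X)) -` {p. (\<lambda>(t, X). P t X) p = 0})"
    by (intro closed_vimage closed_roots continuous_intros)
  ultimately have "closed Z" by simp
  moreover have "Z \<subseteq> cball 0 R" using bd[of t0] by (auto simp: Z_def)
  ultimately have "compact Z"
    by (meson bounded_cball bounded_subset compact_eq_bounded_closed)
  obtain N e F where N: "\<And>X0. X0 \<in> Z \<Longrightarrow> open (N X0) \<and> X0 \<in> N X0 \<and> e X0 > 0 \<and> finite (F X0) \<and>
       (\<forall>f\<in>F X0. f holomorphic_on ball t0 (e X0) \<and> (\<forall>t\<in>ball t0 (e X0). P t (f t) = 0)) \<and>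
       (\<forall>t\<in>ball t0 (e X0). \<forall>X\<in>N X0. P t X = 0 \<longrightarrow> (\<exists>f\<in>F X0. X = f t))"
    using loc unfolding Z_def mem_Collect_eq by metis
  obtain Z' where Z': "Z' \<subseteq> Z" "finite Z'" "Z \<subseteq> (\<Union>X0\<in>Z'. N X0)"
    using compactE_image[OF \<open>compact Z\<close>, of Z N] N by blast
  define W where "W = (\<Union>X0\<in>Z'. N X0)"
  have "open W" using N Z' by (auto simp: W_def)
  \<comment> \<open>Pairs whose root lies outside the chosen neighbourhoods. The projection to the
    parameter is compact and misses \<open>t0\<close>, so a whole disc about \<open>t0\<close> is
    free of such roots.\<close>
  define K where "K = (cball t0 1 \<times> (cball 0 R - W)) \<inter> {p. (\<lambda>(t, X). P t X) p = 0}"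
  have "compact K"
    unfolding K_def using \<open>open W\<close> closed_roots
    by (intro compact_Int_closed compact_Times compact_diff) auto
  then have "compact (fst ` K)" by (intro compact_continuous_image continuous_intros)
  then have "open (- (fst ` K))" by (simp add: compact_imp_closed open_Compl)
  moreover have "t0 \<notin> fst ` K" using Z' by (auto simp: K_def W_def Z_def)
  ultimately obtain d where d: "d > 0" "ball t0 d \<subseteq> - (fst ` K)"
    using open_contains_ball by (metis ComplI)
  define E where "E = Min (insert 1 (insert d (e ` Z')))"
  have E: "E > 0" "E \<le> 1" "E \<le> d" "\<And>X0. X0 \<in> Z' \<Longrightarrow> E \<le> e X0"
  proof -
    have fin: "finite (insert 1 (insert d (e ` Z')))" using Z' by simp
    show "E > 0" unfolding E_def using fin Z' N d by (subst Min_gr_iff) auto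
    show "E \<le> 1" "E \<le> d" "\<And>X0. X0 \<in> Z' \<Longrightarrow> E \<le> e X0"
      unfolding E_def using fin by (auto intro!: Min_le simp del: Min_insert)
  qed
  have "continuable P (ball t0 E)"
  proof (rule continuable_finite[of "\<Union>X0\<in>Z'. F X0"])
    show "finite (\<Union>X0\<in>Z'. F X0)" using Z' N by blast
    show "f holomorphic_on ball t0 E" if f: "f \<in> (\<Union>X0\<in>Z'. F X0)" for f
    proof -
      obtain X0 where X0: "X0 \<in> Z'" "f \<in> F X0" using f by blast
      then have "f holomorphic_on ball t0 (e X0)" using N Z' by blast
      then show ?thesis using E(4)[OF X0(1)] by (meson holomorphic_on_subset subset_ball)
    qed
    show "P t (f t) = 0" if f: "f \<in> (\<Union>X0\<in>Z'. F X0)" and t: "t \<in> ball t0 E" for f t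
    proof -
      obtain X0 where X0: "X0 \<in> Z'" "f \<in> F X0" using f by blast
      then have "t \<in> ball t0 (e X0)" using t E(4)[OF X0(1)] by auto
      then show ?thesis using X0 N Z' by blast
    qed
    show "\<exists>f\<in>(\<Union>X0\<in>Z'. F X0). X = f t" if t: "t \<in> ball t0 E" and X: "P t X = 0" for t X
    proof -
      have "t \<in> cball t0 1" "t \<notin> fst ` K" using t E d by (auto simp: subset_iff)
      then have "X \<in> W" using bd[OF _ X] X by (force simp: K_def image_iff)
      then obtain X0 where X0: "X0 \<in> Z'" "X \<in> N X0" by (auto simp: W_def)
      then have "t \<in> ball t0 (e X0)" using t E(4)[OF X0(1)] by auto
      then have "\<exists>f\<in>F X0. X = f t" using N[of X0] X0 Z'(1) X by blast
      then show ?thesis using X0(1) by blast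
    qed
  qed
  then show ?thesis using E(1) by blast
qed

section \<open>Local solutions of the quintic\<close>

lemma local_holomorphic_root:
  fixes g :: "complex \<Rightarrow> complex"
  assumes "open S" "a \<in> S" "g holomorphic_on S" "g a \<noteq> 0" "n > 0"
  obtains e h where "e > 0" "ball a e \<subseteq> S" "h holomorphic_on ball a e" "\<And>z. z \<in> ball a e \<Longrightarrow> h z ^ n = g z"
    "\<And>z. z \<in> ball a e \<Longrightarrow> g z \<noteq> 0"
proof -
  have "continuous_on S (\<lambda>z. g z / g a)"
    using assms holomorphic_on_imp_continuous_on by (intro continuous_intros) auto
  then have "open (S \<inter> (\<lambda>z. g z / g a) -` ball 1 1)"
    by (intro continuous_open_preimage assms open_ball)
  moreover have "a \<in> S \<inter> (\<lambda>z. g z / g a) -` ball 1 1" using assms by auto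
  ultimately have "\<exists>e>0. ball a e \<subseteq> S \<inter> (\<lambda>z. g z / g a) -` ball 1 1"
    by (rule open_contains_ball[THEN iffD1, rule_format])
  then obtain e where e: "e > 0" "ball a e \<subseteq> S \<inter> (\<lambda>z. g z / g a) -` ball 1 1"
    by blast
  \<comment> \<open>\<open>Ln\<close> is applied to the quotient, which stays near 1, so
    \<open>g a\<close> itself may lie on the branch cut.\<close>
  define h where "h z = exp ((Ln (g z / g a) + Ln (g a)) / of_nat n)" for z
  have pos: "Re (g z / g a) > 0" if "z \<in> ball a e" for z
  proof -
    have "g z / g a \<in> ball 1 1" using e(2) that by blast
    then have "norm (1 - g z / g a) < 1" by (simp only: mem_ball dist_norm)
    then show ?thesis using complex_Re_le_cmod[of "1 - g z / g a"] by simp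
  qed
  then have nn: "g z / g a \<notin> \<real>\<^sub>\<le>\<^sub>0" if "z \<in> ball a e" for z
    using pos[OF that] unfolding complex_nonpos_Reals_iff by linarith
  have nz: "g z \<noteq> 0" if "z \<in> ball a e" for z using pos[OF that] by auto
  have hh: "h holomorphic_on ball a e"
    unfolding h_def using nn assms e
    by (intro holomorphic_intros) (auto intro: holomorphic_on_subset)
  have hn: "h z ^ n = g z" if "z \<in> ball a e" for z
  proof -
    have "h z ^ n = exp (Ln (g z / g a) + Ln (g a))"
      unfolding h_def using assms(5) by (simp flip: exp_of_nat_mult)
    also have "\<dots> = g z" using nz[OF that] assms(4) by (simp add: exp_add)
    finally show ?thesis .
  qed
  show ?thesis
    by (rule that[OF e(1) _ hh hn nz]) (use e(2) in auto)
qed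

text \<open>This is Klein's quintic resolvent of the icosahedron in normalised form. If \<open>x\<close>, \<open>y\<close>, \<open>z\<close> are
  coprime polynomials with \<open>x^2 + y^3 = 1728 z^5\<close>, its splitting field is unramified at all finite
  points, although the quintic itself has triple roots where \<open>y\<close> vanishes.\<close>

definition quintic :: "complex \<Rightarrow> complex \<Rightarrow> complex \<Rightarrow> complex" where
  "quintic x z X = X ^ 5 - 10 * z * X ^ 3 + 45 * z ^ 2 * X - x"

text \<open>The absolute value of a monic quintic at \<open>X0\<close> is the product of the
  distances to its five roots; if all of these were at least \<open>d\<close>, it would be at least
  \<open>d ^ 5\<close>.\<close>

lemma quintic_root_near:
  assumes "norm (quintic x z X0) < d ^ 5" "d > 0"
  shows "\<exists>X. quintic x z X = 0 \<and> norm (X - X0) < d"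
proof -
  define Q where "Q = [:-x, 45 * z ^ 2, 0, -10 * z, 0, 1:]"
  have Q: "poly Q X = quintic x z X" for X
    by (simp add: Q_def quintic_def algebra_simps eval_nat_numeral)
  have "degree Q = 5" "lead_coeff Q = 1" by (simp_all add: Q_def)
  moreover obtain root where "smult (lead_coeff Q) (\<Prod>i<degree Q. [:- root i, 1:]) = Q"
    by (rule complex_poly_decompose')
  ultimately have r: "(\<Prod>i<5. [:- root i, 1:]) = Q" by simp
  have Qr: "poly Q X = (\<Prod>i<5. X - root i)" for X
    unfolding r[symmetric] by (simp add: poly_prod)
  have "\<exists>i<5. norm (X0 - root i) < d"
  proof (rule ccontr)
    assume "\<not> ?thesis"
    then have "(\<Prod>i<5::nat. d) \<le> (\<Prod>i<5. norm (X0 - root i))"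
      using assms by (intro prod_mono) (meson lessThan_iff less_imp_le not_less)
    then show False using assms by (simp add: Q[symmetric] Qr prod_norm)
  qed
  then obtain i where "i < 5" "norm (X0 - root i) < d" by blast
  moreover have "quintic x z (root i) = 0"
    using \<open>i < 5\<close> by (auto simp: Q[symmetric] Qr prod_zero_iff)
  ultimately show ?thesis by (metis norm_minus_commute)
qed

text \<open>Serves twice: for compactness of the roots over a disc, and for polynomial growth of an
  entire root.\<close>

lemma quintic_root_bound:
  assumes "quintic x z X = 0"
  shows "norm X \<le> 1 + 10 * norm z + 45 * norm z ^ 2 + norm x"
proof (cases "norm X \<le> 1")
  case True
  then show ?thesis by (smt (verit) norm_ge_zero zero_le_power)
next
  case False
  then have X: "norm X \<ge> 1" by simp
  have "X ^ 5 = 10 * z * X ^ 3 - 45 * z ^ 2 * X + x" using assms by (simp add: quintic_def algebra_simps)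
  then have "norm X ^ 5 = norm (10 * z * X ^ 3 - 45 * z ^ 2 * X + x)" by (metis norm_power)
  also have "\<dots> \<le> norm (10 * z * X ^ 3) + norm (45 * z ^ 2 * X) + norm x"
    by (meson norm_triangle_ineq norm_triangle_ineq4 add_right_mono order_trans)
  also have "\<dots> = 10 * norm z * norm X ^ 3 + 45 * norm z ^ 2 * norm X ^ 1 + norm x * norm X ^ 0"
    by (simp add: norm_mult norm_power)
  also have "\<dots> \<le> 10 * norm z * norm X ^ 4 + 45 * norm z ^ 2 * norm X ^ 4 + norm x * norm X ^ 4"
    using X by (intro add_mono mult_left_mono power_increasing) auto
  finally have "norm X ^ 4 * norm X \<le> norm X ^ 4 * (10 * norm z + 45 * norm z ^ 2 + norm x)"
    by (simp add: algebra_simps eval_nat_numeral)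
  moreover have "norm X ^ 4 > 0" using X by (intro zero_less_power) linarith
  ultimately have "norm X \<le> 10 * norm z + 45 * norm z ^ 2 + norm x" by (simp only: mult_le_cancel_left_pos)
  then show ?thesis by simp
qed

text \<open>The derivative of the quintic in \<open>X\<close> is
  \<open>5 * (X ^ 2 - 3 * z) ^ 2\<close>, so the hypothesis \<open>simple\<close> says that the root
  is simple, and the claim is an implicit function theorem with a single branch.\<close>

lemma quintic_local_simple_root:
  fixes x z :: "complex \<Rightarrow> complex"
  assumes hol: "x holomorphic_on UNIV" "z holomorphic_on UNIV"
    and root: "quintic (x t0) (z t0) X0 = 0" and simple: "X0 ^ 2 \<noteq> 3 * z t0"
  shows "\<exists>N e F. open N \<and> X0 \<in> N \<and> e > 0 \<and> finite F \<and>
       (\<forall>f\<in>F. f holomorphic_on ball t0 e \<and> (\<forall>t\<in>ball t0 e. quintic (x t) (z t) (f t) = 0)) \<and>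
       (\<forall>t\<in>ball t0 e. \<forall>X\<in>N. quintic (x t) (z t) X = 0 \<longrightarrow> (\<exists>f\<in>F. X = f t))"
proof -
  \<comment> \<open>The divided difference of the quintic in \<open>X\<close>; on the diagonal it is
    the derivative. A lower bound for it near the root gives uniqueness, continuity and
    differentiability of the solution at once.\<close>
  define D where "D t X Y = X ^ 4 + X ^ 3 * Y + X ^ 2 * Y ^ 2 + X * Y ^ 3 + Y ^ 4
      - 10 * z t * (X ^ 2 + X * Y + Y ^ 2) + 45 * z t ^ 2" for t X Y
  have D: "quintic (x t) (z t) X - quintic (x t) (z t) Y = (X - Y) * D t X Y" for t X Y
    by (simp add: quintic_def D_def algebra_simps eval_nat_numeral)
  have cx: "continuous_on UNIV x" "continuous_on UNIV z"
    using hol holomorphic_on_imp_continuous_on by auto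
  have cx': "isCont x t" "isCont z t" for t
    using cx by (auto simp: continuous_on_eq_continuous_at)
  have "D t0 X0 X0 = 5 * (X0 ^ 2 - 3 * z t0) ^ 2"
    by (simp add: D_def algebra_simps eval_nat_numeral)
  then have D0: "D t0 X0 X0 \<noteq> 0" using simple by simp
  define m where "m = norm (D t0 X0 X0) / 2"
  have m: "m > 0" using D0 by (simp add: m_def)
  have "continuous_on UNIV (\<lambda>p. norm (D (fst p) (fst (snd p)) (snd (snd p))))"
    unfolding D_def
    by (intro continuous_intros continuous_on_compose2[OF cx(2)]) auto
  then have "open ((\<lambda>p. norm (D (fst p) (fst (snd p)) (snd (snd p)))) -` {m<..})"
    by (intro open_vimage) auto
  moreover have "(t0, X0, X0) \<in> (\<lambda>p. norm (D (fst p) (fst (snd p)) (snd (snd p)))) -` {m<..}"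
    using m by (simp add: m_def)
  ultimately obtain A B where AB: "open A" "open B" "t0 \<in> A" "(X0, X0) \<in> B"
      "A \<times> B \<subseteq> (\<lambda>p. norm (D (fst p) (fst (snd p)) (snd (snd p)))) -` {m<..}"
    by (rule open_prod_elim) auto
  obtain B1 B2 where B12: "open B1" "open B2" "X0 \<in> B1" "X0 \<in> B2" "B1 \<times> B2 \<subseteq> B"
    using AB(2,4) by (rule open_prod_elim) auto
  have "open (B1 \<inter> B2)" "X0 \<in> B1 \<inter> B2" using B12 by auto
  then obtain d where d: "d > 0" "ball X0 d \<subseteq> B1 \<inter> B2" by (meson open_contains_ball)
  have "isCont (\<lambda>t. quintic (x t) (z t) X0) t0"
    unfolding quintic_def by (intro continuous_intros cx')
  then have "isCont (\<lambda>t. norm (quintic (x t) (z t) X0)) t0" by (rule continuous_norm)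
  then have "((\<lambda>t. norm (quintic (x t) (z t) X0)) \<longlongrightarrow> norm (quintic (x t0) (z t0) X0)) (nhds t0)"
    unfolding continuous_at by (rule tendsto_at_iff_tendsto_nhds[THEN iffD1])
  then have "eventually (\<lambda>t. norm (quintic (x t) (z t) X0) < d ^ 5) (nhds t0)"
    using d root by (intro order_tendstoD(2)[of _ 0]) auto
  moreover have "eventually (\<lambda>t. t \<in> A) (nhds t0)" using AB by (simp add: eventually_nhds_in_open)
  ultimately have "eventually (\<lambda>t. norm (quintic (x t) (z t) X0) < d ^ 5 \<and> t \<in> A) (nhds t0)"
    by (rule eventually_conj)
  then obtain e where e: "e > 0" "\<And>t. t \<in> ball t0 e \<Longrightarrow> norm (quintic (x t) (z t) X0) < d ^ 5 \<and> t \<in> A"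
    by (auto simp: eventually_nhds_metric dist_commute)
  have Dm: "norm (D t X Y) > m" if "t \<in> ball t0 e" "X \<in> ball X0 d" "Y \<in> ball X0 d" for t X Y
  proof -
    have "(t, X, Y) \<in> A \<times> B" using e(2)[OF that(1)] that d B12 by blast
    then show ?thesis using AB(5) by auto
  qed
  obtain s where s: "\<And>t. t \<in> ball t0 e \<Longrightarrow> quintic (x t) (z t) (s t) = 0 \<and> s t \<in> ball X0 d"
  proof -
    have "\<exists>X. quintic (x t) (z t) X = 0 \<and> X \<in> ball X0 d" if "t \<in> ball t0 e" for t
      using quintic_root_near[OF _ d(1), of "x t" "z t" X0] e(2)[OF that]
      by (simp add: dist_norm norm_minus_commute[of X0])
    then show ?thesis using that by metis
  qed
  have uniq: "X = s t" if "t \<in> ball t0 e" "X \<in> ball X0 d" "quintic (x t) (z t) X = 0" for t X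
    using D[of t X "s t"] Dm[of t X "s t"] s[of t] that m by auto
  have "s field_differentiable at t1" if t1: "t1 \<in> ball t0 e" for t1
  proof -
    define G where "G t = quintic (x t) (z t) (s t1)" for t
    have "G holomorphic_on UNIV"
      unfolding G_def quintic_def by (intro holomorphic_intros hol)
    then obtain a where a: "(G has_field_derivative a) (at t1)"
      by (auto simp: holomorphic_on_def field_differentiable_def)
    have G1: "G t1 = 0" using s[OF t1] by (simp add: G_def)
    \<comment> \<open>Both \<open>s t\<close> and \<open>s t1\<close> are roots, for the parameters
      \<open>t\<close> and \<open>t1\<close>; comparing them in the quintic at \<open>t\<close>
      leaves only \<open>G t\<close>, which is holomorphic in \<open>t\<close> and vanishes at
      \<open>t1\<close>.\<close>
    have st: "s t - s t1 = - G t / D t (s t) (s t1)" if "t \<in> ball t0 e" for t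
    proof -
      have "D t (s t) (s t1) \<noteq> 0" using Dm[OF that, of "s t" "s t1"] s[OF that] s[OF t1] m by auto
      moreover have "(s t - s t1) * D t (s t) (s t1) = - G t"
        using D[of t "s t" "s t1"] s[OF that] by (simp add: G_def)
      ultimately show ?thesis by (metis nonzero_eq_divide_eq)
    qed
    have evb: "eventually (\<lambda>t. t \<in> ball t0 e) (at t1)"
      using t1 by (intro eventually_at_in_open') auto
    have "((\<lambda>t. s t - s t1) \<longlongrightarrow> 0) (at t1)"
    proof (rule tendsto_norm_zero_cancel, rule real_tendsto_sandwich[OF _ _ tendsto_const])
      show "eventually (\<lambda>t. 0 \<le> norm (s t - s t1)) (at t1)" by simp
      show "eventually (\<lambda>t. norm (s t - s t1) \<le> norm (G t) / m) (at t1)"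
        using evb
      proof eventually_elim
        case (elim t)
        have "norm (s t - s t1) = norm (G t) / norm (D t (s t) (s t1))"
          using st[OF elim] by (simp add: norm_divide)
        also have "\<dots> \<le> norm (G t) / m"
          using Dm[OF elim, of "s t" "s t1"] s[OF elim] s[OF t1] m
          by (intro divide_left_mono mult_pos_pos) (auto intro: less_trans[OF m])
        finally show ?case .
      qed
      have "(G \<longlongrightarrow> 0) (at t1)"
        using a G1 DERIV_isCont by (metis isCont_def)
      from tendsto_divide[OF tendsto_norm[OF this] tendsto_const[of m]] m
      show "((\<lambda>t. norm (G t) / m) \<longlongrightarrow> 0) (at t1)" by simp
    qed
    then have sc: "(s \<longlongrightarrow> s t1) (at t1)" by (simp add: LIM_zero_iff)
    have D1: "D t1 (s t1) (s t1) \<noteq> 0" using Dm[OF t1, of "s t1" "s t1"] s[OF t1] m by auto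
    have zc: "(z \<longlongrightarrow> z t1) (at t1)" using cx' by (simp add: isCont_def)
    have "((\<lambda>t. - ((G t - G t1) / (t - t1)) / D t (s t) (s t1)) \<longlongrightarrow> - a / D t1 (s t1) (s t1)) (at t1)"
      unfolding D_def
      by (intro tendsto_intros sc zc a[unfolded has_field_derivative_iff] D1[unfolded D_def])
    moreover have "eventually (\<lambda>t. (s t - s t1) / (t - t1) = - ((G t - G t1) / (t - t1)) / D t (s t) (s t1)) (at t1)"
      using evb by eventually_elim (simp add: st G1)
    then have "eventually (\<lambda>t. - ((G t - G t1) / (t - t1)) / D t (s t) (s t1) = (s t - s t1) / (t - t1)) (at t1)"
      by eventually_elim (rule sym)
    ultimately have "((\<lambda>t. (s t - s t1) / (t - t1)) \<longlongrightarrow> - a / D t1 (s t1) (s t1)) (at t1)"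
      by (rule Lim_transform_eventually)
    then show ?thesis by (auto simp: field_differentiable_def has_field_derivative_iff)
  qed
  then have "s holomorphic_on ball t0 e"
    by (auto simp: holomorphic_on_def intro: field_differentiable_at_within)
  then show ?thesis
    using d e s uniq by (intro exI[of _ "ball X0 d"] exI[of _ e] exI[of _ "{s}"]) auto
qed

text \<open>With \<open>r = X^2 / z\<close> the equation becomes \<open>(r - 3)^3 (r^2 - 11 r + 64) = - y^3 / z^5\<close>. The right-hand
  side is a cube of a holomorphic function, so a local coordinate at \<open>r = 3\<close> yields three
  single-valued solutions.\<close>

lemma quintic_local_triple_root:
  fixes x y z :: "complex \<Rightarrow> complex"
  assumes hol: "x holomorphic_on UNIV" "y holomorphic_on UNIV" "z holomorphic_on UNIV"
    and eq: "\<And>t. x t ^ 2 + y t ^ 3 = 1728 * z t ^ 5"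
    and root: "quintic (x t0) (z t0) X0 = 0" and triple: "X0 ^ 2 = 3 * z t0" and z0: "z t0 \<noteq> 0"
  shows "\<exists>N e F. open N \<and> X0 \<in> N \<and> e > 0 \<and> finite F \<and>
       (\<forall>f\<in>F. f holomorphic_on ball t0 e \<and> (\<forall>t\<in>ball t0 e. quintic (x t) (z t) (f t) = 0)) \<and>
       (\<forall>t\<in>ball t0 e. \<forall>X\<in>N. quintic (x t) (z t) X = 0 \<longrightarrow> (\<exists>f\<in>F. X = f t))"
proof -
  \<comment> \<open>At \<open>X0 ^ 2 = 3 * z\<close> the bracket is
    \<open>(9 - 30 + 45) * z ^ 2\<close>. Squaring gives 576 * 3 = 1728, the constant of the
    equation, so \<open>y\<close> vanishes at \<open>t0\<close>.\<close>
  have "x t0 = X0 * (X0 ^ 2 * X0 ^ 2 - 10 * z t0 * X0 ^ 2 + 45 * z t0 ^ 2)"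
    using root by (simp add: quintic_def algebra_simps eval_nat_numeral)
  also have "\<dots> = 24 * X0 * z t0 ^ 2" unfolding triple by (simp add: algebra_simps power2_eq_square)
  finally have "x t0 ^ 2 = 576 * X0 ^ 2 * z t0 ^ 4"
    by (simp add: power_mult_distrib flip: power_mult)
  then have "x t0 ^ 2 = 1728 * z t0 ^ 5" unfolding triple by (simp add: eval_nat_numeral)
  then have y0: "y t0 = 0" using eq[of t0] by simp
  have ccube: "(\<lambda>r :: complex. r ^ 2 - 11 * r + 64) holomorphic_on UNIV" by (intro holomorphic_intros)
  obtain \<rho>1 c where c: "\<rho>1 > 0" "c holomorphic_on ball 3 \<rho>1"
      "\<And>r. r \<in> ball 3 \<rho>1 \<Longrightarrow> c r ^ 3 = r ^ 2 - 11 * r + 64"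
    by (rule local_holomorphic_root[OF open_UNIV UNIV_I ccube, of 3 3]) auto
  have c3: "c 3 \<noteq> 0" using c(1) c(3)[of 3] by auto
  \<comment> \<open>A cube root of \<open>(r - 3) ^ 3 * (r ^ 2 - 11 * r + 64)\<close> near 3, where
    the quadratic factor is 40. Its zero at 3 is simple, so it is a local coordinate there.\<close>
  define k where "k r = (r - 3) * c r" for r
  have kh: "k holomorphic_on ball 3 (min 1 \<rho>1)"
    unfolding k_def by (intro holomorphic_intros holomorphic_on_subset[OF c(2)]) auto
  have "(c has_field_derivative deriv c 3) (at 3)"
    using c by (intro holomorphic_derivI[of _ "ball 3 \<rho>1"]) auto
  then have "(k has_field_derivative (c 3)) (at 3)"
    unfolding k_def by (auto intro!: derivative_eq_intros)
  then have dk: "deriv k 3 \<noteq> 0" using c3 DERIV_imp_deriv by metis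
  obtain \<rho> where \<rho>: "\<rho> > 0" "ball (3 :: complex) \<rho> \<subseteq> ball 3 (min 1 \<rho>1)" "open (k ` ball 3 \<rho>)" "inj_on k (ball 3 \<rho>)"
    by (rule has_complex_derivative_locally_invertible[OF kh _ open_ball dk]) (use c in auto)
  obtain \<kappa> where \<kappa>: "\<kappa> holomorphic_on k ` ball 3 \<rho>" "\<And>r. r \<in> ball 3 \<rho> \<Longrightarrow> \<kappa> (k r) = r"
    using holomorphic_has_inverse[OF holomorphic_on_subset[OF kh \<rho>(2)] open_ball \<rho>(4)] by metis
  have k3: "k r ^ 3 = (r - 3) ^ 3 * (r ^ 2 - 11 * r + 64)" if "r \<in> ball 3 \<rho>" for r
    using c(3)[of r] \<rho>(2) that by (auto simp: k_def power_mult_distrib)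
  \<comment> \<open>With \<open>r = X ^ 2 / z\<close> the quintic reads
    \<open>x = X * z ^ 2 * q r\<close>. This recovers \<open>X\<close> from \<open>r\<close> by a
    division instead of a square root, so each \<open>r\<close> yields one single-valued
    solution.\<close>
  define q where "q r = r ^ 2 - 10 * r + 45" for r :: complex
  have q: "q r \<noteq> 0" "r \<noteq> 0" if "r \<in> ball 3 \<rho>" for r
  proof -
    have "norm (r - 3) < 1" using that \<rho>(2) by (auto simp: dist_norm norm_minus_commute)
    moreover have "norm (r - 3) ^ 2 \<le> 1" using calculation by (simp add: power_le_one)
    moreover have "norm ((r - 3) ^ 2 - 4 * (r - 3)) \<le> norm (r - 3) ^ 2 + 4 * norm (r - 3)"
      using norm_triangle_ineq4[of "(r - 3) ^ 2" "4 * (r - 3)"] by (simp only: norm_mult norm_power norm_numeral)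
    ultimately have "norm ((r - 3) ^ 2 - 4 * (r - 3)) < 24" by linarith
    moreover have "q r = ((r - 3) ^ 2 - 4 * (r - 3)) + 24" by (simp add: q_def algebra_simps power2_eq_square)
    ultimately show "q r \<noteq> 0"
      by (metis add_eq_0_iff2 less_irrefl norm_minus_cancel norm_numeral)
    show "r \<noteq> 0" using \<open>norm (r - 3) < 1\<close> by auto
  qed
  have qid: "r * q r ^ 2 - 1728 = (r - 3) ^ 3 * (r ^ 2 - 11 * r + 64)" for r
    by (simp add: q_def algebra_simps eval_nat_numeral)
  have kinv: "\<kappa> w \<in> ball 3 \<rho>" "k (\<kappa> w) = w" if "w \<in> k ` ball 3 \<rho>" for w using that \<kappa>(2) by auto
  have "0 \<in> k ` ball 3 \<rho>" using \<rho>(1) by (intro image_eqI[of _ _ 3]) (auto simp: k_def)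
  then obtain \<eta> where \<eta>: "\<eta> > 0" "ball 0 \<eta> \<subseteq> k ` ball 3 \<rho>" using \<rho>(3) open_contains_ball by meson
  have cx': "isCont x t" "isCont y t" "isCont z t" for t
    using hol[THEN holomorphic_on_imp_continuous_on] by (auto simp: continuous_on_eq_continuous_at)
  define S where "S = {t. z t \<noteq> 0}"
  have "open (z -` (-{0}))"
    using hol(3) by (intro open_vimage) (auto intro: holomorphic_on_imp_continuous_on)
  moreover have "z -` (-{0}) = S" by (auto simp: S_def)
  ultimately have S: "open S" "t0 \<in> S" using z0 by (auto simp: S_def)
  have "(\<lambda>t. 1 / z t ^ 5) holomorphic_on S"
    using hol by (intro holomorphic_intros) (auto simp: S_def intro: holomorphic_on_subset)
  then obtain e1 h where e1: "e1 > 0" "ball t0 e1 \<subseteq> S" "h holomorphic_on ball t0 e1"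
      "\<And>t. t \<in> ball t0 e1 \<Longrightarrow> h t ^ 3 = 1 / z t ^ 5"
    by (rule local_holomorphic_root[OF S, of "\<lambda>t. 1 / z t ^ 5" 3]) (use z0 in auto)
  \<comment> \<open>Chosen with \<open>g ^ 3 = - y ^ 3 / z ^ 5\<close>, the right-hand side of the
    equation for \<open>r\<close>; as \<open>y\<close> vanishes at \<open>t0\<close>, the values of
    \<open>g\<close> stay in the range of the coordinate \<open>k\<close>.\<close>
  define g where "g t = - y t * h t" for t
  have gh: "g holomorphic_on ball t0 e1"
    unfolding g_def using hol e1 by (intro holomorphic_intros) (auto intro: holomorphic_on_subset)
  then have "isCont g t0" using e1(1) holomorphic_on_imp_continuous_on
    by (metis centre_in_ball continuous_on_eq_continuous_at open_ball)
  then have "(g \<longlongrightarrow> g t0) (nhds t0)"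
    unfolding continuous_at by (rule tendsto_at_iff_tendsto_nhds[THEN iffD1])
  moreover have "g t0 = 0" by (simp add: g_def y0)
  ultimately have "eventually (\<lambda>t. norm (g t) < \<eta>) (nhds t0)"
    using \<eta>(1) by (metis tendsto_norm_zero order_tendstoD(2))
  then obtain e2 where e2: "e2 > 0" "\<And>t. t \<in> ball t0 e2 \<Longrightarrow> norm (g t) < \<eta>"
    by (auto simp: eventually_nhds_metric dist_commute)
  have "isCont (\<lambda>p. fst p ^ 2 / z (snd p)) (X0, t0)"
    using z0 by (intro continuous_intros isCont_o2[OF _ cx'(3)]) auto
  then have "((\<lambda>p. fst p ^ 2 / z (snd p)) \<longlongrightarrow> X0 ^ 2 / z t0) (nhds (X0, t0))"
    unfolding continuous_at by (subst (asm) tendsto_at_iff_tendsto_nhds) simp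
  moreover have "X0 ^ 2 / z t0 = 3" using triple z0 by simp
  ultimately have "eventually (\<lambda>p. fst p ^ 2 / z (snd p) \<in> ball 3 \<rho>) (nhds (X0, t0))"
    using \<rho>(1) by (intro topological_tendstoD) auto
  then obtain W where W: "open W" "(X0, t0) \<in> W" "\<And>p. p \<in> W \<Longrightarrow> fst p ^ 2 / z (snd p) \<in> ball 3 \<rho>"
    by (auto simp: eventually_nhds)
  obtain N T where NT: "open N" "open T" "X0 \<in> N" "t0 \<in> T" "N \<times> T \<subseteq> W"
    using W(1,2) by (rule open_prod_elim) auto
  obtain e3 where e3: "e3 > 0" "ball t0 e3 \<subseteq> T" using NT open_contains_ball by meson
  define e where "e = min e1 (min e2 e3)"
  have e: "e > 0" "ball t0 e \<subseteq> ball t0 e1" "ball t0 e \<subseteq> ball t0 e2" "ball t0 e \<subseteq> ball t0 e3"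
    using e1 e2 e3 by (auto simp: e_def)
  have g3: "g t ^ 3 * z t ^ 5 = - (y t ^ 3)" "z t \<noteq> 0" if "t \<in> ball t0 e" for t
  proof -
    have "t \<in> ball t0 e1" using that e by blast
    then show "z t \<noteq> 0" using e1(2) by (auto simp: S_def)
    then show "g t ^ 3 * z t ^ 5 = - (y t ^ 3)"
      using e1(4)[OF \<open>t \<in> ball t0 e1\<close>] by (simp add: g_def power_mult_distrib)
  qed
  \<comment> \<open>The equation becomes \<open>k r ^ 3 = g t ^ 3\<close>, so \<open>k r\<close> and
    \<open>g t\<close> differ by a cube root of unity; each such root gives one branch.\<close>
  define C where "C = {\<omega> :: complex. \<omega> ^ 3 = 1}"
  have finC: "finite C" using finite_roots_unity[of 3] by (simp add: C_def)
  have C2: "norm \<omega> = 1" if "\<omega> \<in> C" for \<omega>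
  proof -
    have "norm \<omega> ^ 3 = 1 ^ 3" using that by (simp add: C_def flip: norm_power)
    then show "norm \<omega> = 1" by (rule power_eq_imp_eq_base) auto
  qed
  define R where "R \<omega> t = \<kappa> (\<omega> * g t)" for \<omega> t
  define f where "f \<omega> t = x t / (z t ^ 2 * q (R \<omega> t))" for \<omega> t
  have im: "\<omega> * g t \<in> k ` ball 3 \<rho>" if "\<omega> \<in> C" "t \<in> ball t0 e" for \<omega> t
    using e2(2)[of t] e that C2[OF that(1)] \<eta>(2) by (auto simp: norm_mult subset_iff)
  have R: "R \<omega> t \<in> ball 3 \<rho>" "k (R \<omega> t) = \<omega> * g t" if "\<omega> \<in> C" "t \<in> ball t0 e" for \<omega> t
    using kinv[OF im[OF that]] by (auto simp: R_def)
  have "f \<omega> holomorphic_on ball t0 e" if "\<omega> \<in> C" for \<omega>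
  proof -
    have "(\<kappa> \<circ> (\<lambda>t. \<omega> * g t)) holomorphic_on ball t0 e"
      using im[OF that] by (intro holomorphic_on_compose_gen[OF _ \<kappa>(1)] holomorphic_intros
        holomorphic_on_subset[OF gh e(2)]) auto
    then have "R \<omega> holomorphic_on ball t0 e" by (simp add: R_def[abs_def] o_def)
    then show ?thesis
      unfolding f_def q_def
      using g3(2) q(1)[OF R(1)[OF that]] hol
      by (intro holomorphic_intros) (auto simp: q_def intro: holomorphic_on_subset)
  qed
  moreover have "quintic (x t) (z t) (f \<omega> t) = 0" if "\<omega> \<in> C" "t \<in> ball t0 e" for \<omega> t
  proof -
    define r where "r = R \<omega> t"
    have r: "r \<in> ball 3 \<rho>" "q r \<noteq> 0" "z t \<noteq> 0" using R[OF that] q g3 that by (auto simp: r_def)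
    have "r * q r ^ 2 - 1728 = g t ^ 3"
      using k3[OF r(1)] R(2)[OF that] that by (simp add: qid r_def C_def power_mult_distrib)
    then have "(r * q r ^ 2 - 1728) * z t ^ 5 = - (y t ^ 3)" using g3 that by simp
    then have x2: "x t ^ 2 = r * q r ^ 2 * z t ^ 5" using eq[of t] by algebra
    define X where "X = f \<omega> t"
    have X: "X * (z t ^ 2 * q r) = x t" using r by (simp add: X_def f_def r_def)
    have "X ^ 2 * (z t ^ 4 * q r ^ 2) = x t ^ 2" by (simp add: X[symmetric] power_mult_distrib flip: power_mult)
    also have "\<dots> = r * z t * (z t ^ 4 * q r ^ 2)" unfolding x2 by (simp add: eval_nat_numeral)
    finally have X2: "X ^ 2 = r * z t" using r by simp
    have "quintic (x t) (z t) X = X * (X ^ 2 * X ^ 2 - 10 * z t * X ^ 2 + 45 * z t ^ 2) - x t"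
      by (simp add: quintic_def algebra_simps eval_nat_numeral)
    also have "X ^ 2 * X ^ 2 - 10 * z t * X ^ 2 + 45 * z t ^ 2 = z t ^ 2 * q r"
      unfolding X2 by (simp add: q_def algebra_simps power2_eq_square)
    finally show ?thesis using X by (simp add: X_def)
  qed
  moreover have "\<exists>\<omega>\<in>C. X = f \<omega> t" if t: "t \<in> ball t0 e" and X: "X \<in> N" "quintic (x t) (z t) X = 0" for t X
  proof -
    define r where "r = X ^ 2 / z t"
    have zt: "z t \<noteq> 0" using g3 t by blast
    have "(X, t) \<in> W" using X t e e3 NT by blast
    then have r: "r \<in> ball 3 \<rho>" using W(3) by (force simp: r_def)
    have X2: "X ^ 2 = r * z t" using zt by (simp add: r_def)
    have "x t = X * (X ^ 2 * X ^ 2 - 10 * z t * X ^ 2 + 45 * z t ^ 2)"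
      using X(2) by (simp add: quintic_def algebra_simps eval_nat_numeral)
    also have "X ^ 2 * X ^ 2 - 10 * z t * X ^ 2 + 45 * z t ^ 2 = z t ^ 2 * q r"
      unfolding X2 by (simp add: q_def algebra_simps power2_eq_square)
    finally have x: "x t = X * (z t ^ 2 * q r)" .
    have "x t ^ 2 = X ^ 2 * (z t ^ 4 * q r ^ 2)" unfolding x by (simp add: power_mult_distrib flip: power_mult)
    also have "\<dots> = r * q r ^ 2 * z t ^ 5" unfolding X2 by (simp add: eval_nat_numeral)
    finally have "(r * q r ^ 2 - 1728) * z t ^ 5 = - (y t ^ 3)" using eq[of t] by algebra
    then have "(r * q r ^ 2 - 1728) * z t ^ 5 = g t ^ 3 * z t ^ 5" using g3 t by simp
    then have kg: "k r ^ 3 = g t ^ 3" using zt k3[OF r] by (simp add: qid)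
    obtain \<omega> where \<omega>: "\<omega> \<in> C" "k r = \<omega> * g t"
    proof (cases "g t = 0")
      case True
      then show ?thesis using kg that[of 1] by (simp add: C_def)
    next
      case False
      then show ?thesis using kg that[of "k r / g t"] by (simp add: C_def power_divide)
    qed
    have "R \<omega> t = r" using \<kappa>(2)[OF r] by (simp add: R_def \<omega>(2)[symmetric])
    then have "X = f \<omega> t" using x q(1)[OF r] zt by (simp add: f_def)
    then show ?thesis using \<omega> by blast
  qed
  ultimately show ?thesis
    using NT e(1) finC by (intro exI[of _ N] exI[of _ e] exI[of _ "f ` C"]) auto
qed

section \<open>From local solutions to a polynomial root\<close>

lemma poly_norm_bound:
  fixes p :: "complex poly"
  obtains B n where "\<And>t. norm t \<ge> 1 \<Longrightarrow> norm (poly p t) \<le> B * norm t ^ n"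
proof -
  have "norm (poly p t) \<le> (\<Sum>i\<le>degree p. norm (coeff p i)) * norm t ^ degree p" if t: "norm t \<ge> 1" for t
  proof -
    have "norm (poly p t) \<le> (\<Sum>i\<le>degree p. norm (coeff p i * t ^ i))"
      unfolding poly_altdef by (rule norm_sum)
    also have "\<dots> \<le> (\<Sum>i\<le>degree p. norm (coeff p i) * norm t ^ degree p)"
      using t by (intro sum_mono) (auto simp: norm_mult norm_power intro!: mult_left_mono power_increasing)
    finally show ?thesis by (simp add: sum_distrib_right)
  qed
  then show ?thesis by (rule that)
qed

lemma holomorphic_poly_growth_imp_poly:
  fixes f :: "complex \<Rightarrow> complex"
  assumes "f holomorphic_on UNIV" "\<And>t. norm t \<ge> 1 \<Longrightarrow> norm (f t) \<le> B * norm t ^ n"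
  obtains p :: "complex poly" where "f = poly p"
proof -
  have "f = poly (\<Sum>k\<le>n. monom ((deriv ^^ k) f 0 / fact k) k)"
    using Liouville_polynomial[OF assms] by (intro ext) (simp add: poly_sum poly_monom)
  then show ?thesis by (rule that)
qed

lemma quintic_poly_root:
  fixes x y z :: "complex poly"
  assumes eq: "x ^ 2 + y ^ 3 = 1728 * z ^ 5" and cop: "coprime x z"
  obtains s where "s ^ 5 - 10 * z * s ^ 3 + 45 * z ^ 2 * s = x"
proof -
  define P where "P t = quintic (poly x t) (poly z t)" for t
  have eq': "poly x t ^ 2 + poly y t ^ 3 = 1728 * poly z t ^ 5" for t
    using arg_cong[OF eq, of "\<lambda>p. poly p t"] by simp
  have hol: "poly p holomorphic_on UNIV" for p :: "complex poly" by (intro holomorphic_intros)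
  have loc: "\<exists>N e F. open N \<and> X0 \<in> N \<and> e > 0 \<and> finite F \<and>
       (\<forall>f\<in>F. f holomorphic_on ball t0 e \<and> (\<forall>t\<in>ball t0 e. P t (f t) = 0)) \<and>
       (\<forall>t\<in>ball t0 e. \<forall>X\<in>N. P t X = 0 \<longrightarrow> (\<exists>f\<in>F. X = f t))"
    if root: "P t0 X0 = 0" for t0 X0
  proof (cases "X0 ^ 2 = 3 * poly z t0")
    case False
    then show ?thesis
      unfolding P_def using root by (intro quintic_local_simple_root hol) (auto simp: P_def)
  next
    case True
    \<comment> \<open>At a common zero of \<open>z\<close> and \<open>X0\<close> the quintic would
      have a quintuple root, which neither local analysis covers; coprimality excludes this.\<close>
    have "poly z t0 \<noteq> 0"
    proof
      assume z: "poly z t0 = 0"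
      then have "poly x t0 = 0" using True root by (simp add: P_def quintic_def)
      then show False using z cop by (metis coprime_poly_0)
    qed
    then show ?thesis
      unfolding P_def using root eq' True
      by (intro quintic_local_triple_root[of "poly x" "poly y" "poly z"] hol) (auto simp: P_def)
  qed
  have cont: "continuous_on UNIV (\<lambda>(t, X). P t X)"
    unfolding P_def quintic_def case_prod_unfold by (intro continuous_intros)
  have bd: "norm X \<le> 1 + 10 * norm (poly z t) + 45 * norm (poly z t) ^ 2 + norm (poly x t)"
    if "P t X = 0" for t X
    using quintic_root_bound that by (simp add: P_def)
  have "\<exists>e>0. continuable P (ball t0 e)" for t0
  proof -
    have "continuous_on (cball t0 1)
        (\<lambda>t. 1 + 10 * norm (poly z t) + 45 * norm (poly z t) ^ 2 + norm (poly x t))"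
      by (intro continuous_intros)
    from compact_imp_bounded[OF compact_continuous_image[OF this compact_cball]]
    obtain R where R: "\<And>t. t \<in> cball t0 1 \<Longrightarrow>
        norm (1 + 10 * norm (poly z t) + 45 * norm (poly z t) ^ 2 + norm (poly x t)) \<le> R"
      unfolding bounded_iff by blast
    have "norm X \<le> R" if "t \<in> cball t0 1" "P t X = 0" for t X
      using R[OF that(1)] bd[OF that(2)] unfolding real_norm_def by linarith
    then show ?thesis using continuable_ball_of_local_roots[OF cont _ loc] by blast
  qed
  then have cU: "continuable P UNIV" by (rule continuable_UNIV)
  \<comment> \<open>The quintic at \<open>t = 0\<close>. A root of it guarantees that the local
    analysis yields at least one branch to continue.\<close>
  define Q where "Q = [:- poly x 0, 45 * poly z 0 ^ 2, 0, -10 * poly z 0, 0, 1:]"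
  have "\<not> constant (poly Q)" by (simp add: constant_degree Q_def)
  then obtain X0 where "poly Q X0 = 0" using fundamental_theorem_of_algebra by blast
  then have X0: "P 0 X0 = 0" by (simp add: Q_def P_def quintic_def algebra_simps eval_nat_numeral)
  from loc[OF this] obtain N e F where F: "X0 \<in> N" "e > 0"
     "\<And>f. f \<in> F \<Longrightarrow> f holomorphic_on ball 0 e" "\<And>f t. f \<in> F \<Longrightarrow> t \<in> ball 0 e \<Longrightarrow> P t (f t) = 0"
     "\<And>t X. t \<in> ball 0 e \<Longrightarrow> X \<in> N \<Longrightarrow> P t X = 0 \<Longrightarrow> \<exists>f\<in>F. X = f t" by metis
  then obtain f where f: "f \<in> F" using X0 centre_in_ball by metis
  obtain \<tau> where \<tau>: "\<tau> holomorphic_on UNIV" "\<And>t. P t (\<tau> t) = 0"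
    by (rule continuableE[OF cU, of "ball 0 e" f]) (use F f in auto)
  obtain Bx nx where Bx: "\<And>t. norm t \<ge> 1 \<Longrightarrow> norm (poly x t) \<le> Bx * norm t ^ nx"
    using poly_norm_bound[of x] by blast
  obtain Bz nz where Bz: "\<And>t. norm t \<ge> 1 \<Longrightarrow> norm (poly z t) \<le> Bz * norm t ^ nz"
    using poly_norm_bound[of z] by blast
  note B = Bx Bz
  have Bpos: "Bx \<ge> 0" "Bz \<ge> 0"
    using order_trans[OF norm_ge_zero Bx[of 1]] order_trans[OF norm_ge_zero Bz[of 1]] by simp_all
  define n where "n = nx + 2 * nz"
  have "norm (\<tau> t) \<le> (1 + 10 * Bz + 45 * Bz ^ 2 + Bx) * norm t ^ n" if t: "norm t \<ge> 1" for t
  proof -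
    have pw: "norm t ^ k \<le> norm t ^ n" if "k \<le> n" for k using t that by (intro power_increasing)
    have "norm (poly z t) \<le> Bz * norm t ^ n"
      using B(2)[OF t] mult_left_mono[OF pw[of nz] Bpos(2)] by (simp add: n_def)
    moreover have "norm (poly x t) \<le> Bx * norm t ^ n"
      using B(1)[OF t] mult_left_mono[OF pw[of nx] Bpos(1)] by (simp add: n_def)
    moreover have "norm (poly z t) ^ 2 \<le> Bz ^ 2 * norm t ^ n"
    proof -
      have "norm (poly z t) ^ 2 \<le> (Bz * norm t ^ nz) ^ 2" using B(2)[OF t] by (intro power_mono) auto
      also have "\<dots> = Bz ^ 2 * norm t ^ (2 * nz)" by (simp add: power_mult_distrib power_mult mult.commute flip: power_mult)
      also have "\<dots> \<le> Bz ^ 2 * norm t ^ n" by (intro mult_left_mono pw) (auto simp: n_def)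
      finally show ?thesis .
    qed
    moreover have "1 \<le> norm t ^ n" using t by simp
    ultimately show ?thesis using bd[OF \<tau>(2)[of t]] by (simp add: algebra_simps)
  qed
  then obtain s where s: "\<tau> = poly s" using holomorphic_poly_growth_imp_poly[OF \<tau>(1)] by metis
  have "s ^ 5 - 10 * z * s ^ 3 + 45 * z ^ 2 * s = x"
  proof (rule poly_eq_poly_eq_iff[THEN iffD1], rule ext)
    fix t show "poly (s ^ 5 - 10 * z * s ^ 3 + 45 * z ^ 2 * s) t = poly x t"
      using \<tau>(2)[of t] by (simp add: s P_def quintic_def)
  qed
  then show ?thesis by (rule that)
qed

section \<open>Sums of powers of coprime polynomials\<close>

lemma coprime_iff_no_common_root:
  fixes p q :: "complex poly"
  shows "coprime p q \<longleftrightarrow> (\<forall>w. \<not> (poly p w = 0 \<and> poly q w = 0))"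
proof
  assume "coprime p q"
  then show "\<forall>w. \<not> (poly p w = 0 \<and> poly q w = 0)" using coprime_poly_0 by blast
next
  assume no: "\<forall>w. \<not> (poly p w = 0 \<and> poly q w = 0)"
  show "coprime p q"
  proof (rule coprimeI)
    fix c assume c: "c dvd p" "c dvd q"
    have "poly c w \<noteq> 0" for w using c no by (metis dvdE mult_zero_left poly_mult)
    then have "constant (poly c)" using fundamental_theorem_of_algebra by blast
    then have "degree c = 0" by (simp add: constant_degree)
    moreover have "c \<noteq> 0" using \<open>poly c 0 \<noteq> 0\<close> by auto
    ultimately show "is_unit c" by (simp add: is_unit_iff_degree)
  qed
qed

lemma complex_nth_root_exists:
  assumes "n > 0"
  obtains r :: complex where "r ^ n = c"
  using assms nth_root_exists by metis

lemma order_power: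
  fixes p :: "'a :: idom poly"
  assumes "p \<noteq> 0"
  shows "order w (p ^ n) = n * order w p"
  using assms by (induction n) (simp_all add: order_mult)

text \<open>Over the complex numbers the leading coefficient also has an n-th root, so the
  multiplicities alone decide.\<close>

lemma poly_power_of_orders:
  fixes p :: "complex poly"
  assumes "n > 0" "\<And>w. n dvd order w p"
  obtains r where "p = r ^ n"
proof -
  obtain c where c: "c ^ n = lead_coeff p" using complex_nth_root_exists[OF assms(1)] by metis
  have "p = smult (lead_coeff p) (\<Prod>z | poly p z = 0. [:-z, 1:] ^ order z p)"
    by (rule complex_poly_decompose[symmetric])
  also have "\<dots> = smult (c ^ n) (\<Prod>z | poly p z = 0. ([:-z, 1:] ^ (order z p div n)) ^ n)"
    using assms(2) by (simp add: c flip: power_mult)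
  also have "\<dots> = (smult c (\<Prod>z | poly p z = 0. [:-z, 1:] ^ (order z p div n))) ^ n"
    by (simp add: smult_power prod_power_distrib)
  finally show ?thesis by (rule that)
qed

lemma coprime_mult_eq_power:
  fixes u v w :: "complex poly"
  assumes "u * v = w ^ n" "coprime u v" "w \<noteq> 0" "n > 0"
  obtains r s where "u = r ^ n" "v = s ^ n"
proof -
  have nz: "u * v \<noteq> 0" using assms by simp
  have sum: "order t u + order t v = n * order t w" for t
    using order_mult[OF nz, of t] assms(1) order_power[OF assms(3), of t n] by simp
  have "order t u = 0 \<or> order t v = 0" for t
    using assms(2) nz by (auto simp: coprime_iff_no_common_root order_eq_0_iff)
  then have "n dvd order t u" "n dvd order t v" for t
    using sum[of t] by (metis add.left_neutral add.right_neutral dvd_0_right dvd_triv_left)+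
  then show ?thesis using poly_power_of_orders[OF assms(4)] that by metis
qed

lemma degree_sum_eq_bound:
  assumes "degree p \<le> M" "degree q \<le> M" "degree (p + q) = M"
  shows "degree p = M \<or> degree q = M"
  using assms degree_add_le_max[of p q] by linarith

text \<open>Mason--Stothers: the Wronskian of \<open>x^a\<close> and \<open>z^c\<close> is, up to sign, that of any two of the three
  terms, hence divisible by \<open>x^(a - 1) y^(b - 1) z^(c - 1)\<close>.\<close>

lemma fermat_catalan_degree_bound:
  fixes x y z :: "complex poly"
  assumes eq: "x ^ a + y ^ b = z ^ c" and cop: "coprime x y" and pos: "a > 0" "b > 0" "c > 0"
    and N: "a * degree x = N" "N > 0" and z: "z \<noteq> 0"
  shows "b * degree y + 1 \<le> degree x + degree y + degree z"
proof -
  have x: "x \<noteq> 0" using N by auto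
  have rts: "poly x w ^ a + poly y w ^ b = poly z w ^ c" for w
    using arg_cong[OF eq, of "\<lambda>p. poly p w"] by simp
  have cxy: "\<not> (poly x w = 0 \<and> poly y w = 0)" for w using cop by (simp add: coprime_iff_no_common_root)
  have cxz: "coprime x z" and cyz: "coprime y z"
    using rts cxy pos unfolding coprime_iff_no_common_root
    by (metis add.left_neutral add.right_neutral power_eq_0_iff zero_power)+
  define W where "W = x ^ a * pderiv (z ^ c) - pderiv (x ^ a) * z ^ c"
  have W2: "W = pderiv (y ^ b) * z ^ c - y ^ b * pderiv (z ^ c)"
    by (simp add: W_def eq[symmetric] pderiv_add algebra_simps)
  have dv: "p ^ (n - 1) dvd p ^ n" "p ^ (n - 1) dvd pderiv (p ^ n)" for p :: "complex poly" and n
    by (auto simp: pderiv_power le_imp_power_dvd dvd_smult)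
  have "x ^ (a - 1) dvd W" "z ^ (c - 1) dvd W"
    unfolding W_def using dv[of x a] dv[of z c] by (auto intro!: dvd_diff intro: dvd_mult dvd_mult2)
  moreover have "y ^ (b - 1) dvd W"
    unfolding W2 using dv[of y b] by (auto intro!: dvd_diff intro: dvd_mult dvd_mult2)
  ultimately have "x ^ (a - 1) * y ^ (b - 1) * z ^ (c - 1) dvd W"
    using cop cxz cyz by (intro divides_mult) auto
  \<comment> \<open>If \<open>W\<close> vanished, \<open>x ^ a\<close>, being coprime to
    \<open>z ^ c\<close>, would divide its own derivative, which is nonzero of smaller
    degree.\<close>
  moreover have "W \<noteq> 0"
  proof
    assume "W = 0"
    then have "x ^ a dvd pderiv (x ^ a) * z ^ c" by (metis W_def dvd_triv_left right_minus_eq)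
    then have "x ^ a dvd pderiv (x ^ a)" using cxz by (simp add: coprime_dvd_mult_left_iff)
    moreover have d: "degree (x ^ a) > 0" using N x by (simp add: degree_power_eq)
    ultimately show False
      using dvd_imp_degree_le[of "x ^ a" "pderiv (x ^ a)"]
      by (auto simp: degree_pderiv pderiv_eq_0_iff)
  qed
  ultimately have "degree (x ^ (a - 1) * y ^ (b - 1) * z ^ (c - 1)) \<le> degree W"
    by (rule dvd_imp_degree_le)
  moreover have "y \<noteq> 0"
  proof
    assume "y = 0"
    then have "is_unit x" using cop by simp
    then show False using N by (auto simp: is_unit_iff_degree x)
  qed
  ultimately have le: "(a - 1) * degree x + (b - 1) * degree y + (c - 1) * degree z \<le> degree W"
    using x z by (simp add: degree_mult_eq degree_power_eq)
  \<comment> \<open>Each product contains one derivative and so loses a degree; if \<open>z\<close>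
    is constant, the product with its derivative vanishes instead. Cancelling
    \<open>a * degree x\<close> and \<open>c * degree z\<close> against the lower bound leaves the
    claim about \<open>y\<close>.\<close>
  have "degree W < a * degree x + c * degree z"
  proof -
    have "degree (x ^ a * pderiv (z ^ c)) < a * degree x + c * degree z"
    proof (cases "degree (z ^ c) = 0")
      case True
      then have "pderiv (z ^ c) = 0" by (simp add: pderiv_eq_0_iff)
      then show ?thesis using N by simp
    next
      case False
      have "degree (x ^ a * pderiv (z ^ c)) \<le> degree (x ^ a) + (degree (z ^ c) - 1)"
        by (metis degree_mult_le degree_pderiv)
      moreover have "degree (z ^ c) > 0" using False by simp
      ultimately show ?thesis using x z unfolding degree_power_eq[OF x] degree_power_eq[OF z] by linarith
    qed
    moreover have "degree (pderiv (x ^ a) * z ^ c) < a * degree x + c * degree z"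
    proof -
      have "degree (pderiv (x ^ a) * z ^ c) \<le> (degree (x ^ a) - 1) + degree (z ^ c)"
        by (metis degree_mult_le degree_pderiv)
      then show ?thesis using N x z by (simp add: degree_power_eq)
    qed
    ultimately show ?thesis unfolding W_def by (rule degree_diff_less)
  qed
  moreover have "a * degree x = (a - 1) * degree x + degree x" "b * degree y = (b - 1) * degree y + degree y"
      "c * degree z = (c - 1) * degree z + degree z"
    using pos by (auto simp: algebra_simps diff_mult_distrib)
  ultimately show ?thesis using le by linarith
qed

section \<open>Spherical triples of exponents\<close>

lemma sum_of_squares_power:
  fixes x y z :: "complex poly"
  assumes eq: "x ^ 2 + y ^ 2 = z ^ c" and cop: "coprime x y" and deg: "degree x = M" "degree y = M"
    and z: "z \<noteq> 0" "c > 0"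
  shows "c dvd M"
proof -
  define u v where "u = x + smult \<i> y" and "v = x - smult \<i> y"
  have "u * v = z ^ c" by (simp add: u_def v_def eq[symmetric] power2_eq_square algebra_simps)
  moreover have "coprime u v"
    unfolding coprime_iff_no_common_root
  proof (intro allI notI)
    fix w assume "poly u w = 0 \<and> poly v w = 0"
    then have "poly x w + \<i> * poly y w = 0" "poly x w - \<i> * poly y w = 0" by (auto simp: u_def v_def)
    moreover from this have "2 * poly x w = 0" by algebra
    ultimately have "poly x w = 0 \<and> poly y w = 0" by simp
    then show False using cop by (auto simp: coprime_iff_no_common_root)
  qed
  ultimately obtain r s where rs: "u = r ^ c" "v = s ^ c" using coprime_mult_eq_power z by metis
  \<comment> \<open>The two conjugate factors are c-th powers. Their sum is a multiple of
    \<open>x\<close>, so one of them has the full degree M, which makes M a multiple of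
    \<open>c\<close>.\<close>
  have "u + v = smult 2 x" by (rule poly_eq_poly_eq_iff[THEN iffD1], rule ext) (simp add: u_def v_def)
  then have "degree (u + v) = M" using deg by simp
  moreover have "degree u \<le> M" "degree v \<le> M"
    unfolding u_def v_def using deg by (auto intro!: degree_add_le degree_diff_le)
  ultimately have "degree u = M \<or> degree v = M" by (intro degree_sum_eq_bound)
  moreover have "c dvd degree (p ^ c)" for p :: "complex poly"
    using z by (cases "p = 0") (auto simp: degree_power_eq zero_power)
  ultimately show ?thesis using rs by metis
qed

text \<open>The tetrahedral triple. The sum of cubes splits into three pairwise coprime linear forms
  in \<open>x\<close> and \<open>y\<close>; their product is a square, so each is a square.\<close>

lemma sum_of_cubes_square:
  fixes x y z :: "complex poly"
  assumes eq: "x ^ 3 + y ^ 3 = z ^ 2" and cop: "coprime x y" and deg: "degree x = M" "degree y = M"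
    and z: "z \<noteq> 0"
  shows "2 dvd M"
proof -
  obtain \<omega> :: complex where om: "\<omega> ^ 2 + \<omega> + 1 = 0"
  proof -
    have "\<not> constant (poly [:1, 1, 1 :: complex:])" by (simp add: constant_degree)
    then obtain \<omega> where "poly [:1, 1, 1 :: complex:] \<omega> = 0" using fundamental_theorem_of_algebra by blast
    then show ?thesis by (intro that[of \<omega>]) (simp add: algebra_simps power2_eq_square)
  qed
  have om1: "\<omega> \<noteq> 1" "\<omega> \<noteq> 0" "\<omega> ^ 2 \<noteq> 1" "\<omega> ^ 2 \<noteq> \<omega>"
  proof -
    show "\<omega> \<noteq> 1" "\<omega> \<noteq> 0" using om by auto
    have "\<omega> ^ 3 = 1" using om by algebra
    moreover have "\<omega> ^ 3 = \<omega> ^ 2 * \<omega>" by (simp add: eval_nat_numeral)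
    ultimately show "\<omega> ^ 2 \<noteq> 1" using \<open>\<omega> \<noteq> 1\<close> by auto
    then show "\<omega> ^ 2 \<noteq> \<omega>" using \<open>\<omega> \<noteq> 1\<close> \<open>\<omega> \<noteq> 0\<close> by (simp add: power2_eq_square)
  qed
  define u v w where "u = x + y" and "v = x + smult \<omega> y" and "w = x + smult (\<omega> ^ 2) y"
  have key: "(a + b) * ((a + \<omega> * b) * (a + \<omega> ^ 2 * b)) = a ^ 3 + b ^ 3" for a b
    using om by algebra
  have prod: "u * (v * w) = z ^ 2"
    unfolding eq[symmetric]
    by (rule poly_eq_poly_eq_iff[THEN iffD1], rule ext) (simp add: u_def v_def w_def key)
  have cops: "coprime (x + smult \<alpha> y) (x + smult \<beta> y)" if "\<alpha> \<noteq> \<beta>" for \<alpha> \<beta>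
    unfolding coprime_iff_no_common_root
  proof (intro allI notI)
    fix t assume t: "poly (x + smult \<alpha> y) t = 0 \<and> poly (x + smult \<beta> y) t = 0"
    have "(\<alpha> - \<beta>) * poly y t = poly (x + smult \<alpha> y) t - poly (x + smult \<beta> y) t"
      by (simp add: algebra_simps)
    also have "\<dots> = 0" using t by simp
    finally have "(\<alpha> - \<beta>) * poly y t = 0" .
    then have "poly y t = 0" using that by simp
    moreover have "poly x t = 0" using t calculation by simp
    ultimately show False using cop by (auto simp: coprime_iff_no_common_root)
  qed
  have "coprime u v" "coprime u w" "coprime v w"
    using cops[of 1 \<omega>] cops[of 1 "\<omega> ^ 2"] cops[of \<omega> "\<omega> ^ 2"] om1 by (auto simp: u_def v_def w_def)
  obtain r s where rs: "u = r ^ 2" "v * w = s ^ 2"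
    using coprime_mult_eq_power[OF prod _ z] \<open>coprime u v\<close> \<open>coprime u w\<close> by (metis coprime_mult_right_iff zero_less_numeral)
  have "s \<noteq> 0" using prod rs z by auto
  then obtain p q where pq: "v = p ^ 2" "w = q ^ 2"
    using coprime_mult_eq_power[OF rs(2) \<open>coprime v w\<close>] by (metis zero_less_numeral)
  \<comment> \<open>The difference of two of the squares is a nonzero multiple of \<open>y\<close>,
    so one of them has the full degree M.\<close>
  have "v + (- u) = smult (\<omega> - 1) y" by (simp add: u_def v_def algebra_simps smult_diff_left)
  then have "degree (v + (- u)) = M" using deg om1 by simp
  moreover have "degree (- u) \<le> M" "degree v \<le> M"
    unfolding u_def v_def degree_minus using deg by (auto intro!: degree_add_le)
  ultimately have "degree v = M \<or> degree (- u) = M" by (intro degree_sum_eq_bound)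
  then have "degree v = M \<or> degree u = M" by simp
  moreover have "2 dvd degree (p ^ 2)" for p :: "complex poly"
    by (cases "p = 0") (auto simp: degree_power_eq)
  ultimately show ?thesis using rs pq by metis
qed

text \<open>The octahedral triple. The difference of \<open>z ^ 4\<close> and \<open>x ^ 2\<close>
  factors into two coprime cubes, whose sum \<open>2 * z ^ 2\<close> is an instance of the
  tetrahedral equation.\<close>

lemma sum_of_square_and_cube_fourth_power:
  fixes x y z :: "complex poly"
  assumes eq: "x ^ 2 + y ^ 3 = z ^ 4" and cop: "coprime x y"
    and deg: "2 * degree x = N" "3 * degree y = N" and nz: "x \<noteq> 0" "y \<noteq> 0" "z \<noteq> 0"
  shows "4 dvd N"
proof -
  define u v where "u = z ^ 2 - x" and "v = z ^ 2 + x"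
  have uv: "u * v = y ^ 3"
  proof -
    have "u * v = z ^ 4 - x ^ 2" by (simp add: u_def v_def algebra_simps power2_eq_square eval_nat_numeral)
    then show ?thesis by (simp add: eq[symmetric])
  qed
  have cuv: "coprime u v"
    unfolding coprime_iff_no_common_root
  proof (intro allI notI)
    fix w assume "poly u w = 0 \<and> poly v w = 0"
    then have "poly x w = 0" "poly u w = 0"
      unfolding u_def v_def poly_add poly_diff by algebra+
    moreover have "poly y w ^ 3 = 0" using calculation uv by (metis mult_zero_left poly_mult poly_power)
    ultimately show False using cop by (auto simp: coprime_iff_no_common_root)
  qed
  then obtain r s where rs: "u = r ^ 3" "v = s ^ 3"
    using coprime_mult_eq_power[OF uv] nz by (metis zero_less_numeral)
  have nz': "r \<noteq> 0" "s \<noteq> 0" using uv rs nz by auto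
  have "degree (x ^ 2 + y ^ 3) \<le> N" using deg nz by (intro degree_add_le) (simp_all add: degree_power_eq)
  then have "2 * degree z \<le> degree x" using deg nz by (simp add: eq degree_power_eq)
  then have "degree (z ^ 2) \<le> degree x" using nz by (simp add: degree_power_eq)
  then have le: "degree u \<le> degree x" "degree v \<le> degree x"
    unfolding u_def v_def by (auto intro!: degree_add_le degree_diff_le)
  \<comment> \<open>Neither degree exceeds \<open>degree x\<close>, and together they make up
    \<open>2 * degree x\<close>, so both are equal to it.\<close>
  have "degree u + degree v = N"
    using nz nz' deg rs uv by (metis degree_mult_eq degree_power_eq power_not_zero)
  with le deg have "degree u = degree x" "degree v = degree x" by linarith+
  then have d: "3 * degree r = degree x" "3 * degree s = degree x" using rs nz' by (simp_all add: degree_power_eq)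
  obtain k :: complex where k: "k ^ 2 = 2" using complex_nth_root_exists[of 2 2] by auto
  have "r ^ 3 + s ^ 3 = (smult k z) ^ 2"
    by (rule poly_eq_poly_eq_iff[THEN iffD1], rule ext) (simp add: rs[symmetric] u_def v_def power_mult_distrib k)
  moreover have "coprime r s" using cuv rs by simp
  moreover have "k \<noteq> 0" using k by auto
  ultimately have "2 dvd degree r" using d nz by (intro sum_of_cubes_square[of r s "smult k z"]) auto
  then show ?thesis using d(1) deg(1) by presburger
qed

text \<open>The root \<open>s\<close> of the quintic reduces the icosahedral equation to the tetrahedral one:
  \<open>x^2 - 1728 z^5\<close> is \<open>(s^2 - 3 z)^3\<close> times a quadratic form in \<open>s^2\<close> and \<open>z\<close>, whose two linear factors
  must be cubes \<open>f^3\<close> and \<open>g^3\<close>, and \<open>s^2\<close> is a linear combination of these.\<close>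

lemma icosahedral_degree:
  fixes x y z :: "complex poly"
  assumes eq: "x ^ 2 + y ^ 3 = 1728 * z ^ 5" and cop: "coprime x z"
    and nz: "x \<noteq> 0" "y \<noteq> 0" "z \<noteq> 0"
  shows "30 dvd max (degree (x ^ 2)) (degree (z ^ 5))"
proof -
  obtain s where s: "s ^ 5 - 10 * z * s ^ 3 + 45 * z ^ 2 * s = x"
    by (rule quintic_poly_root[OF eq cop])
  have s0: "s \<noteq> 0" using s nz by auto
  have csz: "\<not> (poly s w = 0 \<and> poly z w = 0)" for w
  proof
    assume "poly s w = 0 \<and> poly z w = 0"
    then have "poly x w = 0 \<and> poly z w = 0" by (auto simp: s[symmetric])
    then show False using cop by (auto simp: coprime_iff_no_common_root)
  qed
  define p where "p = s ^ 2 - 3 * z"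
  define q where "q = s ^ 4 - 11 * z * s ^ 2 + 64 * z ^ 2"
  have "x ^ 2 - 1728 * z ^ 5 = p ^ 3 * q"
    unfolding s[symmetric] p_def q_def by algebra
  then have pq: "p ^ 3 * q = - (y ^ 3)" using eq by algebra
  have pq0: "p \<noteq> 0" "q \<noteq> 0" using pq nz by auto
  \<comment> \<open>The complementary factor is a cube and so is the product, up to sign.\<close>
  have "3 dvd order w q" for w
  proof -
    have "p ^ 3 * q \<noteq> 0" using pq0 by simp
    then have "order w (p ^ 3 * q) = 3 * order w p + order w q"
      using pq0 by (simp add: order_mult order_power)
    then have "3 * order w p + order w q = 3 * order w y" using nz by (simp add: pq order_power)
    then show ?thesis by (metis dvd_add_right_iff dvd_triv_left)
  qed
  then obtain w where w: "q = w ^ 3" using poly_power_of_orders[of 3 q] by auto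
  \<comment> \<open>\<open>-135 = 11 ^ 2 - 4 * 64\<close> is the discriminant of the quadratic form
    \<open>q\<close> in \<open>s ^ 2\<close> and \<open>z\<close>.\<close>
  obtain d :: complex where d: "d ^ 2 = -135" using complex_nth_root_exists[of 2 "-135"] by auto
  define \<alpha> \<beta> where "\<alpha> = (11 + d) / 2" and "\<beta> = (11 - d) / 2"
  have ab: "\<alpha> + \<beta> = 11" "\<alpha> * \<beta> = 64" "\<beta> - \<alpha> = - d"
    using d by (auto simp: \<alpha>_def \<beta>_def field_simps power2_eq_square)
  have ab0: "\<alpha> \<noteq> 0" "\<beta> \<noteq> 0" "d \<noteq> 0" using ab d by auto
  define u v where "u = s ^ 2 - smult \<alpha> z" and "v = s ^ 2 - smult \<beta> z"
  have "u * v = q"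
  proof (rule poly_eq_poly_eq_iff[THEN iffD1], rule ext)
    fix t
    have "(S ^ 2 - \<alpha> * Z) * (S ^ 2 - \<beta> * Z) = S ^ 4 - (\<alpha> + \<beta>) * Z * S ^ 2 + (\<alpha> * \<beta>) * Z ^ 2" for S Z
      by (simp add: algebra_simps eval_nat_numeral)
    then have "(S ^ 2 - \<alpha> * Z) * (S ^ 2 - \<beta> * Z) = S ^ 4 - 11 * Z * S ^ 2 + 64 * Z ^ 2" for S Z
      unfolding ab(1,2) .
    then show "poly (u * v) t = poly q t" by (simp add: u_def v_def q_def)
  qed
  have "coprime u v"
    unfolding coprime_iff_no_common_root
  proof (intro allI notI)
    fix t assume t: "poly u t = 0 \<and> poly v t = 0"
    have "(\<beta> - \<alpha>) * poly z t = poly u t - poly v t" by (simp add: u_def v_def algebra_simps)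
    also have "\<dots> = 0" using t by simp
    finally have "(\<beta> - \<alpha>) * poly z t = 0" .
    then have "poly z t = 0" using ab ab0 by simp
    moreover have "poly s t = 0" using t calculation by (simp add: u_def)
    ultimately show False using csz by blast
  qed
  have "w \<noteq> 0" using w pq0 by auto
  then obtain f g where fg: "u = f ^ 3" "v = g ^ 3"
    using coprime_mult_eq_power[of u v w 3] \<open>u * v = q\<close> w \<open>coprime u v\<close> by auto
  have fg0: "f \<noteq> 0" "g \<noteq> 0" using fg pq0 \<open>u * v = q\<close> by auto
  define M where "M = max (degree (s ^ 2)) (degree z)"
  have uvM: "degree u \<le> M" "degree v \<le> M"
    unfolding u_def v_def M_def by (auto intro!: degree_diff_le)
  have zuv: "smult (- d) z = u + - v" by (simp add: u_def v_def ab(3)[symmetric] smult_diff_left)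
  have suv: "smult (- d) (s ^ 2) = smult \<beta> u + smult (- \<alpha>) v"
    by (simp add: u_def v_def ab(3)[symmetric] smult_diff_left smult_diff_right mult.commute)
  have two: "2 dvd degree (s ^ 2)" using s0 by (simp add: degree_power_eq)
  have three: "3 dvd degree u" "3 dvd degree v" using fg fg0 by (simp_all add: degree_power_eq)
  \<comment> \<open>If both cubes have degree M, the tetrahedral equation makes
    \<open>degree f\<close> even. If only one has, nothing cancels in the combination giving
    \<open>s ^ 2\<close>, so M is the degree of a square and of a cube.\<close>
  have "2 dvd M \<and> 3 dvd M"
  proof (cases "degree u = M \<and> degree v = M")
    case True
    obtain a where a: "a ^ 3 = \<beta>" using complex_nth_root_exists[of 3 \<beta>] by auto
    obtain b where b: "b ^ 3 = - \<alpha>" using complex_nth_root_exists[of 3 "- \<alpha>"] by auto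
    obtain k where k: "k ^ 2 = - d" using complex_nth_root_exists[of 2 "- d"] by auto
    have abk: "a \<noteq> 0" "b \<noteq> 0" "k \<noteq> 0" using a b k ab0 by auto
    have "(smult a f) ^ 3 + (smult b g) ^ 3 = (smult k s) ^ 2"
      using suv by (simp add: smult_power a b k fg)
    moreover have "coprime (smult a f) (smult b g)"
      using \<open>coprime u v\<close> fg abk by (simp add: coprime_iff_no_common_root)
    ultimately have "2 dvd degree f"
      using True fg fg0 abk s0
      by (intro sum_of_cubes_square[of "smult a f" "smult b g" "smult k s"]) (auto simp: degree_power_eq)
    then show ?thesis using True three fg fg0 by (auto simp: degree_power_eq)
  next
    case False
    have "degree u = M \<or> degree v = M"
    proof (cases "degree z = M")
      case True
      have "degree (u + - v) = M" unfolding zuv[symmetric] using ab0 True by simp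
      then show ?thesis using degree_sum_eq_bound[of u M "- v"] uvM by simp
    next
      case False
      then have "degree (smult (- d) (s ^ 2)) = M" using ab0 by (auto simp: M_def)
      then show ?thesis
        unfolding suv using degree_sum_eq_bound[of "smult \<beta> u" M "smult (- \<alpha>) v"] uvM ab0 by simp
    qed
    moreover have "degree (s ^ 2) = M"
    proof -
      have "degree (smult \<beta> u + smult (- \<alpha>) v) = M"
        using degree_add_eq_left[of "smult (- \<alpha>) v" "smult \<beta> u"]
          degree_add_eq_right[of "smult \<beta> u" "smult (- \<alpha>) v"] calculation False uvM ab0
        by (cases "degree u = M") (simp_all del: smult_minus_left)
      then show ?thesis unfolding suv[symmetric] using ab0 by simp
    qed
    ultimately show ?thesis using two three by metis
  qed
  then have "6 dvd M" by presburger
  \<comment> \<open>The quintic is weighted homogeneous, with \<open>z\<close> counting twice as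
    much as \<open>s\<close>. If \<open>z\<close> attains M, then \<open>z ^ 5\<close> attains
    \<open>5 * M\<close> and \<open>x ^ 2\<close> cannot exceed it; otherwise \<open>s ^ 5\<close>
    dominates in \<open>x\<close>.\<close>
  moreover have "max (degree (x ^ 2)) (degree (z ^ 5)) = 5 * M"
  proof (cases "degree z = M")
    case True
    have zM: "degree z \<le> M" "2 * degree s \<le> M" using s0 by (auto simp: M_def degree_power_eq)
    have "degree (10 * z * s ^ 3) \<le> M + 3 * degree s"
      using nz s0 zM by (simp add: degree_mult_eq degree_power_eq)
    moreover have "degree (45 * z ^ 2 * s) \<le> 2 * M + degree s"
      using nz s0 zM by (simp add: degree_mult_eq degree_power_eq)
    moreover have "degree (s ^ 5) = 5 * degree s" using s0 by (simp add: degree_power_eq)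
    ultimately have "degree x \<le> max (max (5 * degree s) (M + 3 * degree s)) (2 * M + degree s)"
      unfolding s[symmetric] by (intro degree_add_le degree_diff_le) auto
    then have "2 * degree x \<le> 5 * M" using zM by linarith
    then show ?thesis using True nz by (simp add: degree_power_eq max_def)
  next
    case False
    then have zM: "degree z < 2 * degree s" "M = 2 * degree s" using s0 by (auto simp: M_def degree_power_eq max_def split: if_splits)
    have "degree (10 * z * s ^ 3) < 5 * degree s" "degree (45 * z ^ 2 * s) < 5 * degree s"
      using nz s0 zM by (simp_all add: degree_mult_eq degree_power_eq)
    then have "degree (45 * z ^ 2 * s - 10 * z * s ^ 3) < degree (s ^ 5)"
      using s0 by (intro degree_diff_less) (simp_all add: degree_power_eq)
    then have "degree (s ^ 5 + (45 * z ^ 2 * s - 10 * z * s ^ 3)) = degree (s ^ 5)"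
      by (rule degree_add_eq_left)
    moreover have "s ^ 5 + (45 * z ^ 2 * s - 10 * z * s ^ 3) = x" by (simp flip: s)
    ultimately have "degree x = 5 * degree s" using s0 by (simp add: degree_power_eq)
    then show ?thesis using zM nz by (simp add: degree_power_eq max_def)
  qed
  ultimately show ?thesis by auto
qed

text \<open>The inequality says that the reciprocals sum to more than 1. The exponent
  \<open>c\<close> is the one whose divisibility is at stake, so only \<open>a\<close> and
  \<open>b\<close> are ordered, and triples in which \<open>c\<close> divides one of them need no
  further listing.\<close>

lemma exponent_triples:
  fixes a b c :: nat
  assumes "2 \<le> a" "a \<le> b" "2 \<le> c" and lt: "a * b * c < a * b + b * c + a * c"
  shows "c dvd a \<or> c dvd b \<or> (a = 2 \<and> b = 2) \<or>
    (a, b, c) \<in> {(2, 3, 4), (2, 3, 5), (2, 4, 3), (2, 5, 3), (3, 3, 2), (3, 5, 2)}"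
proof (cases "c = 2 \<and> (even a \<or> even b)")
  case False
  consider "a = 2" | "a = 3" | "a \<ge> 4" using assms(1) by linarith
  then show ?thesis
  proof cases
    case 1
    then have c: "c \<ge> 3" using False assms(3) by (auto simp: le_less)
    have *: "b * c < 2 * b + 2 * c" using lt 1 by simp
    have "b < 6"
    proof (rule ccontr)
      assume "\<not> b < 6"
      then have "6 * c \<le> b * c" by simp
      moreover have "b * 3 \<le> b * c" using c by simp
      ultimately show False using * by linarith
    qed
    then consider "b = 2" | "b = 3" "c < 6" | "b = 4" "c < 4" | "b = 5" "c < 4"
      using * 1 assms(2) by (cases "b = 2 \<or> b = 3 \<or> b = 4 \<or> b = 5") auto
    then show ?thesis
    proof cases
      case 2
      then have "c = 3 \<or> c = 4 \<or> c = 5" using c by auto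
      then show ?thesis using 2 1 by auto
    qed (use 1 c in auto)
  next
    case 2
    have *: "2 * (b * c) < 3 * b + 3 * c" using lt 2 by (simp add: algebra_simps)
    have "c = 2"
    proof (rule ccontr)
      assume "c \<noteq> 2"
      then have "b * 3 \<le> b * c" "3 * c \<le> b * c" using assms 2 by auto
      then show False using * by linarith
    qed
    then have "b \<in> {3, 4, 5}" using * 2 assms(2) by auto
    then show ?thesis using 2 \<open>c = 2\<close> by auto
  next
    case 3
    \<comment> \<open>With \<open>a\<close> and \<open>b\<close> at least 4 and \<open>c\<close> at
      least 2 the reciprocals sum to at most 1/4 + 1/4 + 1/2 = 1.\<close>
    have "(b * c) * 4 \<le> (b * c) * a" using 3 by (intro mult_le_mono2)
    moreover have "(a * c) * 4 \<le> (a * c) * b" using 3 assms(2) by (intro mult_le_mono2) simp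
    moreover have "(a * b) * 2 \<le> a * b * c" using assms(3) by (intro mult_le_mono2)
    moreover have "(b * c) * a = a * b * c" by simp
    moreover have "(a * c) * b = a * b * c" by simp
    ultimately have False using lt by linarith
    then show ?thesis ..
  qed
qed auto

text \<open>The leading terms of the summands may cancel, so \<open>z ^ c\<close> can have degree
  below N and the claim is not a matter of counting degrees. The degree bound restricts the
  exponents to spherical triples, each of which is settled by one of the preceding lemmas.\<close>

lemma fermat_catalan_exponent_dvd:
  fixes x y z :: "complex poly"
  assumes "x ^ a + y ^ b = z ^ c" "coprime x y" "2 \<le> a" "2 \<le> b" "2 \<le> c"
    and "degree (x ^ a) = N" "degree (y ^ b) = N" "N > 0" "z \<noteq> 0"
  shows "c dvd N"
  using assms
proof (induction a b arbitrary: x y rule: linorder_wlog)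
  case (sym a b)
  have "y ^ b + x ^ a = z ^ c" using sym.prems by (simp add: add.commute)
  then show ?case using sym.IH sym.prems by (simp add: coprime_commute)
next
  case (le a b)
  have nz: "x \<noteq> 0" "y \<noteq> 0" using le.prems by (auto simp: power_0_left split: if_splits)
  have d: "a * degree x = N" "b * degree y = N" using le.prems nz by (auto simp: degree_power_eq)
  have "degree (x ^ a + y ^ b) \<le> N" using le.prems by (intro degree_add_le) auto
  then have dz: "c * degree z \<le> N" using le.prems by (simp add: degree_power_eq)
  have "b * degree y + 1 \<le> degree x + degree y + degree z"
    by (rule fermat_catalan_degree_bound[OF le.prems(1,2) _ _ _ d(1)]) (use le.prems in auto)
  then have lt: "N < degree x + degree y + degree z" using d by simp
  \<comment> \<open>This is N < N/a + N/b + N/c with the denominators cleared.\<close>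
  have "N * (a * b * c) < (degree x + degree y + degree z) * (a * b * c)"
    using lt le.prems by (intro mult_strict_right_mono) auto
  also have "\<dots> = (a * degree x) * (b * c) + (b * degree y) * (a * c) + (c * degree z) * (a * b)"
    by (simp add: algebra_simps)
  also have "\<dots> \<le> N * (b * c) + N * (a * c) + N * (a * b)"
    unfolding d using dz by (intro add_mono mult_le_mono1) auto
  also have "\<dots> = N * (a * b + b * c + a * c)" by (simp add: algebra_simps)
  finally have "a * b * c < a * b + b * c + a * c" by simp
  from exponent_triples[OF \<open>2 \<le> a\<close> \<open>a \<le> b\<close> \<open>2 \<le> c\<close> this]
  consider "c dvd a" | "c dvd b" | "a = 2" "b = 2" | "a = 2" "b = 3" "c = 4" | "a = 2" "b = 3" "c = 5"
    | "a = 2" "b = 4" "c = 3" | "a = 2" "b = 5" "c = 3" | "a = 3" "b = 3" "c = 2" | "a = 3" "b = 5" "c = 2"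
    by auto
  then show ?case
  proof cases
    case 1
    then show ?thesis using d by auto
  next
    case 2
    then show ?thesis using d(2) by auto
  next
    case 3
    then have "c dvd degree x"
      using le.prems d by (intro sum_of_squares_power[of x y z c]) auto
    then show ?thesis using d by auto
  next
    case 4
    then have "4 dvd N"
      using le.prems d nz by (intro sum_of_square_and_cube_fourth_power[of x y z N]) auto
    then show ?thesis using 4 by simp
  next
    case 5
    \<comment> \<open>Rescales the fifth power to the coefficient 1728; the two analogous constants
      below do the same, with a sign when the fifth power changes sides.\<close>
    obtain k :: complex where k: "k ^ 5 = 1 / 1728" using complex_nth_root_exists[of 5 "1 / 1728"] by auto
    then have k0: "k \<noteq> 0" by auto
    have "30 dvd max (degree (x ^ 2)) (degree (smult k z ^ 5))"
    proof (rule icosahedral_degree)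
      have "1728 * smult k z ^ 5 = z ^ 5"
        by (rule poly_eq_poly_eq_iff[THEN iffD1], rule ext) (simp add: power_mult_distrib k)
      then show "x ^ 2 + y ^ 3 = 1728 * smult k z ^ 5" using le.prems 5 by simp
      have "poly x w ^ 2 + poly y w ^ 3 = poly z w ^ 5" for w
        using arg_cong[OF le.prems(1), of "\<lambda>p. poly p w"] 5 by simp
      then have "poly y w = 0" if "poly x w = 0" "poly z w = 0" for w
        using that by (metis add_0 power_eq_0_iff zero_neq_numeral zero_power2 power_zero_numeral)
      then show "coprime x (smult k z)"
        using le.prems(2) k0 by (auto simp: coprime_iff_no_common_root)
    qed (use nz le.prems k0 in auto)
    moreover have "max (degree (x ^ 2)) (degree (smult k z ^ 5)) = N"
      using d dz 5 nz le.prems k0 by (simp add: degree_power_eq max_def)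
    ultimately show ?thesis using 5 dvd_trans[of 5 30 N] by simp
  next
    case 6
    \<comment> \<open>With 4 on the left, \<open>y ^ 4 = (y ^ 2) ^ 2\<close> turns the octahedral
      equation into a sum of two squares.\<close>
    have "3 dvd degree x"
      using le.prems d 6 nz
      by (intro sum_of_squares_power[of x "y ^ 2" z 3]) (auto simp: degree_power_eq simp flip: power_mult)
    then show ?thesis using d 6 by auto
  next
    case 7
    obtain k :: complex where k: "k ^ 5 = - 1 / 1728" using complex_nth_root_exists[of 5 "- 1 / 1728"] by auto
    then have k0: "k \<noteq> 0" by auto
    have "30 dvd max (degree (x ^ 2)) (degree (smult k y ^ 5))"
    proof (rule icosahedral_degree)
      have "1728 * smult k y ^ 5 = - (y ^ 5)"
        by (rule poly_eq_poly_eq_iff[THEN iffD1], rule ext) (simp add: power_mult_distrib k)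
      then show "x ^ 2 + (- z) ^ 3 = 1728 * smult k y ^ 5" using le.prems(1) 7 by (simp add: algebra_simps flip: le.prems(1))
    qed (use nz le.prems k0 in \<open>auto simp: coprime_iff_no_common_root\<close>)
    moreover have "max (degree (x ^ 2)) (degree (smult k y ^ 5)) = N"
      using d dz 7 nz le.prems k0 by (simp add: degree_power_eq)
    ultimately show ?thesis using 7 by auto
  next
    case 8
    then have "2 dvd degree x"
      using le.prems d by (intro sum_of_cubes_square[of x y z]) auto
    then show ?thesis using d 8 by auto
  next
    case 9
    obtain k :: complex where k: "k ^ 5 = 1 / 1728" using complex_nth_root_exists[of 5 "1 / 1728"] by auto
    then have k0: "k \<noteq> 0" by auto
    have "30 dvd max (degree (z ^ 2)) (degree (smult k y ^ 5))"
    proof (rule icosahedral_degree)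
      have "1728 * smult k y ^ 5 = y ^ 5"
        by (rule poly_eq_poly_eq_iff[THEN iffD1], rule ext) (simp add: power_mult_distrib k)
      then show "z ^ 2 + (- x) ^ 3 = 1728 * smult k y ^ 5" using le.prems(1) 9 by (simp add: algebra_simps flip: le.prems(1))
      have "poly x w ^ 3 + poly y w ^ 5 = poly z w ^ 2" for w
        using arg_cong[OF le.prems(1), of "\<lambda>p. poly p w"] 9 by simp
      then have "poly x w = 0" if "poly y w = 0" "poly z w = 0" for w
        using that by (metis add.right_neutral power_eq_0_iff zero_power2 power_zero_numeral)
      then show "coprime z (smult k y)"
        using le.prems(2) k0 by (auto simp: coprime_iff_no_common_root)
    qed (use nz le.prems k0 in auto)
    moreover have "max (degree (z ^ 2)) (degree (smult k y ^ 5)) = N"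
      using d dz 9 nz le.prems k0 by (simp add: degree_power_eq)
    ultimately show ?thesis using 9 by auto
  qed
qed

section \<open>Ramification of a pencil of polynomials\<close>

text \<open>The zeros of the member with parameter \<open>c\<close> form the fibre of \<open>p / q\<close> over \<open>c\<close>.\<close>

definition pencil :: "complex poly \<Rightarrow> complex poly \<Rightarrow> cp1 \<Rightarrow> complex poly" where
  "pencil p q c = (case c of Fin a \<Rightarrow> p - smult a q | Infty \<Rightarrow> q)"

lemma pencil_simps [simp]: "pencil p q (Fin a) = p - smult a q" "pencil p q Infty = q"
  by (simp_all add: pencil_def)

text \<open>Two distinct members span the pencil, so coprimality and degrees pass from
  \<open>p\<close> and \<open>q\<close> to any such pair.\<close>

lemma pencil_independent:
  assumes "c \<noteq> c'"
  obtains \<alpha> \<beta> \<gamma> \<delta> where "p = smult \<alpha> (pencil p q c) + smult \<beta> (pencil p q c')"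
    "q = smult \<gamma> (pencil p q c) + smult \<delta> (pencil p q c')"
proof (cases c; cases c')
  fix a b assume c: "c = Fin a" "c' = Fin b"
  then have "b - a \<noteq> 0" using assms by auto
  show ?thesis
    by (rule that[of "b / (b - a)" "- a / (b - a)" "1 / (b - a)" "- 1 / (b - a)"];
        rule poly_eq_poly_eq_iff[THEN iffD1]; rule ext; use \<open>b - a \<noteq> 0\<close> in \<open>simp add: c divide_simps; simp add: algebra_simps\<close>)
next
  fix a assume c: "c = Fin a" "c' = Infty"
  show ?thesis by (rule that[of 1 a 0 1]) (simp_all add: c)
next
  fix a assume c: "c' = Fin a" "c = Infty"
  show ?thesis by (rule that[of a 1 1 0]) (simp_all add: c)
qed (use assms in auto)

lemma pencil_coprime:
  assumes "coprime p q" "c \<noteq> c'"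
  shows "coprime (pencil p q c) (pencil p q c')"
  unfolding coprime_iff_no_common_root
proof (intro allI notI)
  fix w assume w: "poly (pencil p q c) w = 0 \<and> poly (pencil p q c') w = 0"
  obtain \<alpha> \<beta> \<gamma> \<delta> where e: "p = smult \<alpha> (pencil p q c) + smult \<beta> (pencil p q c')"
    "q = smult \<gamma> (pencil p q c) + smult \<delta> (pencil p q c')"
    by (rule pencil_independent[OF assms(2), of p q])
  have "poly p w = 0" "poly q w = 0"
    using w arg_cong[OF e(1), of "\<lambda>p. poly p w"] arg_cong[OF e(2), of "\<lambda>p. poly p w"] by auto
  then show False using assms by (auto simp: coprime_iff_no_common_root)
qed

lemma degree_pencil_le: "degree (pencil p q c) \<le> max (degree p) (degree q)"
  by (cases c) (auto intro!: degree_diff_le)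

text \<open>A drop in degree is a zero at infinity; two distinct members cannot share one, because
  they span \<open>p\<close> and \<open>q\<close>.\<close>

lemma degree_pencil_eq:
  assumes "c \<noteq> c'"
  shows "degree (pencil p q c) = max (degree p) (degree q) \<or> degree (pencil p q c') = max (degree p) (degree q)"
proof -
  obtain \<alpha> \<beta> \<gamma> \<delta> where e: "p = smult \<alpha> (pencil p q c) + smult \<beta> (pencil p q c')"
    "q = smult \<gamma> (pencil p q c) + smult \<delta> (pencil p q c')"
    by (rule pencil_independent[OF assms, of p q])
  have "degree p \<le> max (degree (pencil p q c)) (degree (pencil p q c'))"
    by (subst e(1)) (meson degree_add_le_max degree_smult_le le_trans max.mono)
  moreover have "degree q \<le> max (degree (pencil p q c)) (degree (pencil p q c'))"
    by (subst e(2)) (meson degree_add_le_max degree_smult_le le_trans max.mono)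
  moreover have "degree (pencil p q c) \<le> max (degree p) (degree q)" "degree (pencil p q c') \<le> max (degree p) (degree q)"
    by (rule degree_pencil_le)+
  ultimately show ?thesis by linarith
qed

lemma pencil_nonzero:
  assumes "coprime p q" "max (degree p) (degree q) > 0"
  shows "pencil p q c \<noteq> 0"
proof
  assume z: "pencil p q c = 0"
  obtain c' where "c \<noteq> c'" by (metis cp1.distinct(1))
  then have "is_unit (pencil p q c')" using pencil_coprime[OF assms(1), of c c'] z by simp
  then have "degree (pencil p q c') = 0" using is_unit_iff_degree by (metis not_is_unit_0)
  then show False using degree_pencil_eq[OF \<open>c \<noteq> c'\<close>, of p q] z assms(2) by simp
qed

text \<open>The source of the equation between three powers: three members of a two-dimensional
  space are dependent, and as they are pairwise independent forms, no coefficient vanishes.\<close>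

lemma pencil_relation:
  assumes "c0 \<noteq> c1" "c0 \<noteq> c2" "c1 \<noteq> c2"
  obtains \<alpha> \<beta> where "\<alpha> \<noteq> 0" "\<beta> \<noteq> 0" "pencil p q c0 = smult \<alpha> (pencil p q c1) + smult \<beta> (pencil p q c2)"
proof (cases c0; cases c1; cases c2)
  fix a b c assume c: "c0 = Fin a" "c1 = Fin b" "c2 = Fin c"
  then have ne: "b - c \<noteq> 0" "a - c \<noteq> 0" "b - a \<noteq> 0" using assms by auto
  show ?thesis
  proof (rule that[of "(a - c) / (b - c)" "(b - a) / (b - c)"])
    show "pencil p q c0 = smult ((a - c) / (b - c)) (pencil p q c1) + smult ((b - a) / (b - c)) (pencil p q c2)"
    proof (rule poly_eq_poly_eq_iff[THEN iffD1], rule ext)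
      fix t
      show "poly (pencil p q c0) t = poly (smult ((a - c) / (b - c)) (pencil p q c1) + smult ((b - a) / (b - c)) (pencil p q c2)) t"
        using ne(1) by (simp add: c divide_simps) (simp add: algebra_simps)
    qed
  qed (use ne in auto)
next
  fix b c assume c: "c0 = Infty" "c1 = Fin b" "c2 = Fin c"
  then have ne: "b - c \<noteq> 0" using assms by auto
  show ?thesis
    by (rule that[of "- 1 / (b - c)" "1 / (b - c)"])
      (use ne in simp, use ne in simp, rule poly_eq_poly_eq_iff[THEN iffD1], rule ext, use ne in \<open>simp add: c divide_simps; simp add: algebra_simps\<close>)
next
  fix a c assume c: "c0 = Fin a" "c1 = Infty" "c2 = Fin c"
  then have ne: "c - a \<noteq> 0" using assms by auto
  show ?thesis
    by (rule that[of "c - a" 1]) (use ne in \<open>simp_all add: c smult_diff_left\<close>)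
next
  fix a b assume c: "c0 = Fin a" "c1 = Fin b" "c2 = Infty"
  then have ne: "b - a \<noteq> 0" using assms by auto
  show ?thesis
    by (rule that[of 1 "b - a"]) (use ne in \<open>simp_all add: c smult_diff_left\<close>)
qed (use assms in auto)

lemma ramification_dvd_degree:
  assumes cop: "coprime p q" and pos: "\<And>c. \<nu> c \<ge> 1" and good: "\<not> bad \<nu>"
    and ram: "\<And>c w. \<nu> c dvd order w (pencil p q c)"
  shows "\<nu> c dvd max (degree p) (degree q)"
proof (rule ccontr)
  define N where "N = max (degree p) (degree q)"
  assume "\<not> \<nu> c dvd max (degree p) (degree q)"
  then have nd: "\<not> \<nu> c dvd N" by (simp add: N_def)
  then have "N > 0" by (cases "N = 0") auto
  then have nz: "pencil p q c' \<noteq> 0" for c' using pencil_nonzero[OF cop] by (simp add: N_def)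
  have "\<exists>r. pencil p q c' = r ^ \<nu> c'" for c'
    using poly_power_of_orders[of "\<nu> c'" "pencil p q c'"] pos[of c'] ram[of c'] by (metis One_nat_def Suc_le_lessD)
  then obtain r where r: "\<And>c'. pencil p q c' = r c' ^ \<nu> c'" by metis
  have r0: "r c' \<noteq> 0" for c'
    using nz[of c'] pos[of c'] by (auto simp: r power_0_left)
  have dvd: "\<nu> c' dvd degree (pencil p q c')" for c' using r0 by (simp add: r degree_power_eq)
  then have "degree (pencil p q c) \<noteq> N" using nd by metis
  then have deg: "degree (pencil p q c') = N" if "c' \<noteq> c" for c'
    using degree_pencil_eq[OF that, of p q] by (simp add: N_def)
  have "\<nu> c > 1" using nd pos[of c] by (cases "\<nu> c = 1") auto
  obtain c1 where c1: "c1 \<noteq> c" "\<nu> c1 > 1"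
    using good \<open>\<nu> c > 1\<close> unfolding bad_def by blast
  have "\<nu> c1 \<noteq> \<nu> c" using dvd[of c1] deg[OF c1(1)] nd by auto
  \<comment> \<open>Two weighted points with different weights would be bad, so there is a
    third.\<close>
  then have "{x. \<nu> x > 1} \<noteq> {c1, c}" using good c1(1) unfolding bad_def by blast
  then obtain c2 where c2: "c2 \<noteq> c" "c2 \<noteq> c1" "\<nu> c2 > 1" using c1 \<open>\<nu> c > 1\<close> by blast
  obtain \<alpha> \<beta> where ab: "\<alpha> \<noteq> 0" "\<beta> \<noteq> 0" "pencil p q c = smult \<alpha> (pencil p q c1) + smult \<beta> (pencil p q c2)"
    by (rule pencil_relation[of c c1 c2 p q]) (use c1 c2 in auto)
  obtain a where a: "a ^ \<nu> c1 = \<alpha>" using complex_nth_root_exists[of "\<nu> c1" \<alpha>] c1 by auto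
  obtain b where b: "b ^ \<nu> c2 = \<beta>" using complex_nth_root_exists[of "\<nu> c2" \<beta>] c2 by auto
  have ab0: "a \<noteq> 0" "b \<noteq> 0" using a b ab c1 c2 by (auto simp: power_0_left)
  have "\<nu> c dvd N"
  proof (rule fermat_catalan_exponent_dvd)
    show "smult a (r c1) ^ \<nu> c1 + smult b (r c2) ^ \<nu> c2 = r c ^ \<nu> c"
      using ab(3) by (simp add: smult_power a b r)
    have "coprime (r c1 ^ \<nu> c1) (r c2 ^ \<nu> c2)"
      using pencil_coprime[OF cop, of c1 c2] c2(2) by (simp add: r)
    then have "coprime (r c1) (r c2)" using c1 c2 by simp
    then show "coprime (smult a (r c1)) (smult b (r c2))"
      using ab0 by (simp add: coprime_iff_no_common_root)
    show "degree (smult a (r c1) ^ \<nu> c1) = N" "degree (smult b (r c2) ^ \<nu> c2) = N"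
      using deg c1(1) c2(1) ab a b by (auto simp: smult_power r[symmetric])
  qed (use c1 c2 \<open>\<nu> c > 1\<close> \<open>N > 0\<close> r0 in auto)
  then show False using nd by contradiction
qed

text \<open>Here \<open>P\<close> is regarded as a binary form of degree \<open>N\<close>, which gives it a multiplicity at infinity.\<close>

definition mult_at :: "nat \<Rightarrow> complex poly \<Rightarrow> cp1 \<Rightarrow> nat" where
  "mult_at N P z = (case z of Fin w \<Rightarrow> order w P | Infty \<Rightarrow> N - degree P)"

lemma mult_at_simps [simp]: "mult_at N P (Fin w) = order w P" "mult_at N P Infty = N - degree P"
  by (simp_all add: mult_at_def)

text \<open>Local degrees multiply under composition: the second factor is the local degree of
  \<open>r\<close> at \<open>w\<close>.\<close>

lemma order_pcompose:
  fixes P r :: "complex poly"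
  assumes P: "P \<noteq> 0" and r: "degree r > 0"
  shows "order w (P \<circ>\<^sub>p r) = order (poly r w) P * order w (r - [:poly r w:])"
proof -
  define b where "b = poly r w"
  obtain Q where Q: "P = [:- b, 1:] ^ order b P * Q" "\<not> [:- b, 1:] dvd Q"
    using order_decomp[OF P] by blast
  have Qb: "poly Q b \<noteq> 0" using Q(2) by (simp add: poly_eq_0_iff_dvd)
  have lin: "[:- b, 1:] \<circ>\<^sub>p r = r - [:b:]" by (simp add: pcompose_pCons)
  have pow: "(X ^ n) \<circ>\<^sub>p r = (X \<circ>\<^sub>p r) ^ n" for X n
    by (induction n) (simp_all add: pcompose_1 pcompose_mult)
  have r0: "r - [:b:] \<noteq> 0" using r by auto
  have "P \<circ>\<^sub>p r = (r - [:b:]) ^ order b P * (Q \<circ>\<^sub>p r)"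
    by (subst Q(1)) (simp add: pcompose_mult pow lin)
  moreover have q0: "poly (Q \<circ>\<^sub>p r) w \<noteq> 0" using Qb by (simp add: poly_pcompose b_def)
  moreover have "Q \<circ>\<^sub>p r \<noteq> 0" using q0 by auto
  ultimately show ?thesis
    using r0 by (simp add: order_mult order_power order_0I b_def)
qed

lemma pencil_pcompose: "pencil (p \<circ>\<^sub>p r) (q \<circ>\<^sub>p r) c = pencil p q c \<circ>\<^sub>p r"
  by (cases c) (simp_all add: pcompose_diff pcompose_smult)

lemma coprime_pcompose:
  fixes p q :: "complex poly"
  assumes "coprime p q"
  shows "coprime (p \<circ>\<^sub>p r) (q \<circ>\<^sub>p r)"
  using assms by (auto simp: coprime_iff_no_common_root poly_pcompose)

text \<open>Substituting \<open>w ^ a\<close> for the variable multiplies the multiplicities at \<open>0\<close> and at infinity by \<open>a\<close>.\<close>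

lemma ramification_zero_infinity:
  assumes cop: "coprime p q" and N: "N = max (degree p) (degree q)"
    and pos: "\<And>c. \<nu> c \<ge> 1" and good: "\<not> bad \<nu>" and a: "a \<ge> 1"
    and other: "\<And>c z. z \<noteq> Fin 0 \<Longrightarrow> z \<noteq> Infty \<Longrightarrow> \<nu> c dvd mult_at N (pencil p q c) z"
    and zero: "\<And>c. \<nu> c dvd a * mult_at N (pencil p q c) (Fin 0)"
  shows "\<nu> c dvd a * mult_at N (pencil p q c) Infty"
proof (cases "N = 0")
  case False
  define r where "r = monom (1 :: complex) a"
  have r: "degree r = a" "poly r w = w ^ a" for w by (simp_all add: r_def degree_monom_eq poly_monom)
  have nz: "pencil p q c \<noteq> 0" for c using pencil_nonzero[OF cop] False N by simp
  \<comment> \<open>The derivative of the power map vanishes at most at 0, so elsewhere its local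
    degree is 1.\<close>
  have ord: "order w (r - [:poly r w:]) = (if w = 0 then a else 1)" for w
  proof (cases "w = 0")
    case True
    then show ?thesis using a by (simp add: r) (simp add: r_def power_0_left)
  next
    case False
    have pd: "pderiv (r - [:poly r w:]) = monom (of_nat a) (a - 1)"
      by (simp add: pderiv_diff r_def pderiv_monom)
    then have "pderiv (r - [:poly r w:]) \<noteq> 0" using a by simp
    moreover have "r - [:poly r w:] \<noteq> 0" using calculation by auto
    moreover from this have "order w (r - [:poly r w:]) \<noteq> 0" by (simp add: order_eq_0_iff)
    ultimately have "order w (r - [:poly r w:]) = Suc (order w (monom (of_nat a) (a - 1)))"
      by (metis order_pderiv2 pd)
    moreover have "order w (monom (of_nat a :: complex) (a - 1)) = 0"
      using False a by (intro order_0I) (simp add: poly_monom)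
    ultimately show ?thesis using False by simp
  qed
  have ram: "\<nu> c dvd order w (pencil (p \<circ>\<^sub>p r) (q \<circ>\<^sub>p r) c)" for c w
  proof -
    have "order w (pencil p q c \<circ>\<^sub>p r) = order (w ^ a) (pencil p q c) * (if w = 0 then a else 1)"
      using order_pcompose[OF nz[of c], of r w] a by (simp add: r ord[unfolded r])
    then show ?thesis
      using other[of "Fin (w ^ a)" c] zero[of c] a
      by (cases "w = 0") (auto simp: pencil_pcompose mult.commute power_0_left)
  qed
  have "\<nu> c dvd max (degree (p \<circ>\<^sub>p r)) (degree (q \<circ>\<^sub>p r))"
    by (rule ramification_dvd_degree[OF coprime_pcompose[OF cop] pos good ram])
  also have "max (degree (p \<circ>\<^sub>p r)) (degree (q \<circ>\<^sub>p r)) = a * N"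
    unfolding degree_pcompose r N by (simp add: max_def)
  finally have "\<nu> c dvd a * N" .
  \<comment> \<open>The composed member is a perfect \<open>\<nu> c\<close>-th power. Its degree and
    \<open>a * N\<close> are thus both divisible by \<open>\<nu> c\<close>, and so is their
    difference, \<open>a\<close> times the multiplicity at infinity.\<close>
  moreover have "\<nu> c dvd a * degree (pencil p q c)"
  proof -
    obtain s where s: "pencil (p \<circ>\<^sub>p r) (q \<circ>\<^sub>p r) c = s ^ \<nu> c"
      using poly_power_of_orders[OF _ ram[of c]] pos[of c] by (metis One_nat_def Suc_le_lessD)
    have deg: "degree (pencil (p \<circ>\<^sub>p r) (q \<circ>\<^sub>p r) c) = degree (pencil p q c) * a"
      by (simp add: pencil_pcompose degree_pcompose r)
    show ?thesis
    proof (cases "s = 0")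
      case True
      then show ?thesis using s deg pos[of c] by (auto simp: power_0_left)
    next
      case False
      then show ?thesis using s deg by (metis degree_power_eq dvd_triv_left mult.commute)
    qed
  qed
  ultimately show ?thesis by (simp add: diff_mult_distrib2)
qed auto

section \<open>Changes of coordinate on the source sphere\<close>

definition reflect :: "nat \<Rightarrow> complex poly \<Rightarrow> complex poly" where
  "reflect N P = (\<Sum>i\<le>N. monom (coeff P (N - i)) i)"

lemma coeff_reflect: "coeff (reflect N P) i = (if i \<le> N then coeff P (N - i) else 0)"
  by (simp add: reflect_def coeff_sum if_distrib cong: if_cong)

text \<open>Linearity is the reason for reversing coefficients relative to a common length N instead
  of the degree of each polynomial: the reversal of a pencil is again a pencil.\<close>

lemma reflect_linear: "reflect N (P - smult a Q) = reflect N P - smult a (reflect N Q)"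
  by (rule poly_eqI) (simp add: coeff_reflect)

lemma reflect_reflect: "degree P \<le> N \<Longrightarrow> reflect N (reflect N P) = P"
  by (rule poly_eqI) (auto simp: coeff_reflect coeff_eq_0)

lemma degree_reflect_le: "degree (reflect N P) \<le> N"
  by (rule degree_le) (simp add: coeff_reflect)

lemma pencil_reflect: "pencil (reflect N p) (reflect N q) c = reflect N (pencil p q c)"
  by (cases c) (simp_all add: reflect_linear)

lemma poly_reflect:
  assumes "degree P \<le> N" "w \<noteq> 0"
  shows "poly (reflect N P) w = w ^ N * poly P (1 / w)"
proof -
  have "poly (reflect N P) w = (\<Sum>i\<le>N. coeff P (N - i) * w ^ i)"
    by (simp add: reflect_def poly_sum poly_monom)
  also have "\<dots> = (\<Sum>i\<le>N. coeff P i * w ^ (N - i))"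
    by (rule sum.reindex_bij_witness[of _ "\<lambda>i. N - i" "\<lambda>i. N - i"]) auto
  also have "\<dots> = (\<Sum>i\<le>N. w ^ N * (coeff P i * (1 / w) ^ i))"
    using assms(2) by (intro sum.cong) (auto simp: power_diff power_one_over)
  also have "\<dots> = w ^ N * poly P (1 / w)"
    by (subst poly_as_sum_of_monoms'[OF assms(1), symmetric])
      (simp add: poly_sum poly_monom sum_distrib_left)
  finally show ?thesis .
qed

lemma poly_reflect_0: "poly (reflect N P) 0 = coeff P N"
  by (simp add: poly_0_coeff_0 coeff_reflect)

lemma reflect_eq_0_iff: "degree P \<le> N \<Longrightarrow> reflect N P = 0 \<longleftrightarrow> P = 0"
  by (metis reflect_reflect coeff_0 coeff_reflect poly_eqI)

text \<open>The order at 0 counts the vanishing lowest coefficients, which are the missing top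
  coefficients of \<open>P\<close> up to index N.\<close>

lemma order_0_reflect:
  assumes "P \<noteq> 0" "degree P \<le> N"
  shows "order 0 (reflect N P) = N - degree P"
proof -
  have R: "reflect N P \<noteq> 0" using assms by (simp add: reflect_eq_0_iff)
  have "n \<le> order 0 (reflect N P) \<longleftrightarrow> n \<le> N - degree P" for n
  proof -
    have "n \<le> order 0 (reflect N P) \<longleftrightarrow> (\<forall>k<n. coeff (reflect N P) k = 0)"
      using monom_1_dvd_iff[OF R, of n] by (simp add: monom_1_dvd_iff')
    also have "\<dots> \<longleftrightarrow> n \<le> N - degree P"
    proof
      assume *: "\<forall>k<n. coeff (reflect N P) k = 0"
      show "n \<le> N - degree P"
      proof (rule ccontr)
        assume "\<not> n \<le> N - degree P"
        then have "coeff (reflect N P) (N - degree P) = 0" using * by simp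
        then show False using assms by (simp add: coeff_reflect)
      qed
    qed (auto simp: coeff_reflect coeff_eq_0)
    finally show ?thesis .
  qed
  then show ?thesis by (meson dual_order.antisym order_refl)
qed

text \<open>Splitting off the root \<open>b = 1 / w\<close> with its multiplicity, the reversal
  takes each factor \<open>X - b\<close> to \<open>1 - b * X\<close>, whose root is
  \<open>w\<close>, and the cofactor to its reversal of length \<open>N - m\<close>.\<close>

lemma order_reflect:
  assumes P: "P \<noteq> 0" "degree P \<le> N" and w: "w \<noteq> 0"
  shows "order w (reflect N P) = order (1 / w) P"
proof -
  define b m where "b = 1 / w" and "m = order b P"
  obtain Q where Q: "P = [:- b, 1:] ^ m * Q" "\<not> [:- b, 1:] dvd Q"
    using order_decomp[OF P(1)] unfolding m_def by blast
  have Qb: "poly Q b \<noteq> 0" using Q(2) by (simp add: poly_eq_0_iff_dvd)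
  then have "Q \<noteq> 0" by auto
  then have "degree P = m + degree Q" by (subst Q(1)) (simp add: degree_mult_eq degree_power_eq)
  then have dQ: "degree Q \<le> N - m" "m \<le> N" using P(2) by auto
  have eq: "reflect N P = [:1, - b:] ^ m * reflect (N - m) Q"
  proof (rule poly_eq_poly_eq_iff[THEN iffD1])
    have nz: "poly (reflect N P) t = poly ([:1, - b:] ^ m * reflect (N - m) Q) t" if "t \<noteq> 0" for t
    proof -
      have "poly (reflect N P) t = t ^ N * ((1 / t - b) ^ m * poly Q (1 / t))"
        using that P(2) by (subst poly_reflect) (simp_all add: Q(1))
      also have "t ^ N = t ^ m * t ^ (N - m)" using dQ by (simp flip: power_add)
      also have "t ^ m * t ^ (N - m) * ((1 / t - b) ^ m * poly Q (1 / t))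
          = (t * (1 / t - b)) ^ m * (t ^ (N - m) * poly Q (1 / t))" by (simp add: power_mult_distrib)
      also have "t * (1 / t - b) = 1 - t * b" using that by (simp add: algebra_simps)
      finally show ?thesis using that dQ by (simp add: poly_reflect)
    qed
    \<comment> \<open>The evaluation by \<open>1 / t\<close> says nothing at 0, but polynomials that
      agree at infinitely many points are equal.\<close>
    then have "{t. poly (reflect N P - [:1, - b:] ^ m * reflect (N - m) Q) t = 0} \<supseteq> - {0}" by auto
    moreover have "infinite (- {0 :: complex})" by (simp add: infinite_UNIV_char_0 finite_compl)
    ultimately have "infinite {t. poly (reflect N P - [:1, - b:] ^ m * reflect (N - m) Q) t = 0}"
      using infinite_super by blast
    then have "reflect N P - [:1, - b:] ^ m * reflect (N - m) Q = 0" using poly_roots_finite by blast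
    then show "poly (reflect N P) = poly ([:1, - b:] ^ m * reflect (N - m) Q)" by simp
  qed
  have lin: "[:1, - b:] = smult (- b) [:- w, 1:]" using w by (simp add: b_def)
  have "b \<noteq> 0" using w by (simp add: b_def)
  then have "order w ([:1, - b:] ^ m) = m"
    unfolding lin smult_power by (simp only: order_smult order_power_n_n power_not_zero neg_equal_0_iff_equal not_False_eq_True)
  moreover have "poly (reflect (N - m) Q) w \<noteq> 0" using Qb w dQ by (simp add: poly_reflect b_def)
  moreover have "[:1, - b:] ^ m * reflect (N - m) Q \<noteq> 0"
    using calculation by (auto simp: pCons_eq_0_iff)
  ultimately show ?thesis by (simp add: eq order_mult order_0I m_def b_def)
qed

lemma degree_reflect:
  assumes "P \<noteq> 0" "degree P \<le> N"
  shows "N - degree (reflect N P) = order 0 P"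
  using order_0_reflect[of "reflect N P" N] assms degree_reflect_le
  by (simp add: reflect_reflect reflect_eq_0_iff)

fun cp1_inverse :: "cp1 \<Rightarrow> cp1" where
  "cp1_inverse (Fin w) = (if w = 0 then Infty else Fin (1 / w))"
| "cp1_inverse Infty = Fin 0"

lemma cp1_inverse_inverse [simp]: "cp1_inverse (cp1_inverse z) = z"
  by (cases z) auto

lemma mult_at_reflect:
  assumes "P \<noteq> 0" "degree P \<le> N"
  shows "mult_at N (reflect N P) z = mult_at N P (cp1_inverse z)"
  using assms by (cases z) (auto simp: order_0_reflect order_reflect degree_reflect)

fun cp1_shift :: "complex \<Rightarrow> cp1 \<Rightarrow> cp1" where
  "cp1_shift t (Fin w) = Fin (w + t)"
| "cp1_shift t Infty = Infty"

lemma cp1_shift_cancel [simp]: "cp1_shift t (cp1_shift (- t) z) = z"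
  by (cases z) auto

lemma mult_at_shift:
  assumes "P \<noteq> 0"
  shows "mult_at N (P \<circ>\<^sub>p [:t, 1:]) z = mult_at N P (cp1_shift t z)"
proof (cases z)
  case (Fin w)
  have "[:t, 1:] - [:poly [:t, 1:] w:] = [:- w, 1:]" by simp
  moreover have "order w [:- w, 1:] = 1" using order_power_n_n[of w 1] by simp
  ultimately show ?thesis
    using order_pcompose[OF assms, of "[:t, 1:]" w] Fin by (simp add: add.commute)
qed (simp add: degree_pcompose)

text \<open>A common root other than 0 inverts to a common root of \<open>p\<close> and
  \<open>q\<close>. A common root 0 would mean that both coefficients of index N vanish, which
  coprimality and the choice of N exclude.\<close>

lemma coprime_reflect:
  assumes cop: "coprime p q" and N: "N = max (degree p) (degree q)"
  shows "coprime (reflect N p) (reflect N q)"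
  unfolding coprime_iff_no_common_root
proof (intro allI notI)
  fix w assume w: "poly (reflect N p) w = 0 \<and> poly (reflect N q) w = 0"
  show False
  proof (cases "w = 0")
    case True
    then have "coeff p N = 0" "coeff q N = 0" using w by (auto simp: poly_reflect_0)
    then have "p = 0 \<and> N = degree p \<or> q = 0 \<and> N = degree q"
      using N by (metis leading_coeff_0_iff max_def)
    then have "N = 0" by auto
    then have "p = 0" "q = 0" using \<open>coeff p N = 0\<close> \<open>coeff q N = 0\<close> N
      by (auto simp: leading_coeff_0_iff[symmetric] simp del: leading_coeff_0_iff)
    then show False using cop by simp
  next
    case False
    then show False using w cop N by (auto simp: poly_reflect coprime_iff_no_common_root)
  qed
qed

lemma max_degree_reflect:
  assumes cop: "coprime p q" and N: "N = max (degree p) (degree q)"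
  shows "max (degree (reflect N p)) (degree (reflect N q)) = N"
proof (rule ccontr)
  assume "max (degree (reflect N p)) (degree (reflect N q)) \<noteq> N"
  then have "degree (reflect N p) < N" "degree (reflect N q) < N"
    using degree_reflect_le[of N p] degree_reflect_le[of N q] by linarith+
  then have "coeff (reflect N p) N = 0" "coeff (reflect N q) N = 0" by (auto simp: coeff_eq_0)
  then have "poly p 0 = 0" "poly q 0 = 0" by (auto simp: coeff_reflect poly_0_coeff_0)
  then show False using cop by (auto simp: coprime_iff_no_common_root)
qed

lemma ramification_two_points_infinity:
  assumes cop: "coprime p q" and N: "N = max (degree p) (degree q)"
    and pos: "\<And>c. \<nu> c \<ge> 1" and good: "\<not> bad \<nu>" and a: "a \<ge> 1"
    and other: "\<And>c z. z \<noteq> Fin t \<Longrightarrow> z \<noteq> Infty \<Longrightarrow> \<nu> c dvd mult_at N (pencil p q c) z"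
    and zero: "\<And>c. \<nu> c dvd a * mult_at N (pencil p q c) (Fin t)"
  shows "\<nu> c dvd a * mult_at N (pencil p q c) Infty"
proof (cases "N = 0")
  case False
  have nz: "pencil p q c \<noteq> 0" for c using pencil_nonzero[OF cop] False N by simp
  define r where "r = [:t, 1:]"
  have m: "mult_at N (pencil (p \<circ>\<^sub>p r) (q \<circ>\<^sub>p r) c) z = mult_at N (pencil p q c) (cp1_shift t z)" for c z
    using mult_at_shift[OF nz] by (simp add: pencil_pcompose r_def)
  have "\<nu> c dvd a * mult_at N (pencil (p \<circ>\<^sub>p r) (q \<circ>\<^sub>p r) c) Infty"
  proof (rule ramification_zero_infinity[OF coprime_pcompose[OF cop] _ pos good a])
    show "N = max (degree (p \<circ>\<^sub>p r)) (degree (q \<circ>\<^sub>p r))" by (simp add: degree_pcompose r_def N)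
    show "\<nu> c dvd mult_at N (pencil (p \<circ>\<^sub>p r) (q \<circ>\<^sub>p r) c) z" if "z \<noteq> Fin 0" "z \<noteq> Infty" for c z
      unfolding m using that by (intro other; cases z) auto
    show "\<nu> c dvd a * mult_at N (pencil (p \<circ>\<^sub>p r) (q \<circ>\<^sub>p r) c) (Fin 0)" for c
      unfolding m using zero by simp
  qed
  then show ?thesis unfolding m by simp
qed auto

text \<open>If \<open>z2\<close> is finite, translating it to 0 and inverting moves it to infinity,
  and with it the claim to the case already treated.\<close>

lemma ramification_two_points:
  assumes cop: "coprime p q" and N: "N = max (degree p) (degree q)" "N > 0"
    and pos: "\<And>c. \<nu> c \<ge> 1" and good: "\<not> bad \<nu>" and a: "a \<ge> 1" and z12: "z1 \<noteq> z2"
    and other: "\<And>c z. z \<noteq> z1 \<Longrightarrow> z \<noteq> z2 \<Longrightarrow> \<nu> c dvd mult_at N (pencil p q c) z"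
    and zero: "\<And>c. \<nu> c dvd a * mult_at N (pencil p q c) z1"
  shows "\<nu> c dvd a * mult_at N (pencil p q c) z2"
proof (cases z2)
  case Infty
  then obtain t where "z1 = Fin t" using z12 by (cases z1) auto
  then show ?thesis
    using ramification_two_points_infinity[OF cop N(1) pos good a, of t] other zero Infty by simp
next
  case (Fin u)
  define r where "r = [:u, 1:]"
  define p' q' where "p' = reflect N (p \<circ>\<^sub>p r)" and "q' = reflect N (q \<circ>\<^sub>p r)"
  have nz: "pencil p q c \<noteq> 0" for c using pencil_nonzero[OF cop] N by simp
  have N': "N = max (degree (p \<circ>\<^sub>p r)) (degree (q \<circ>\<^sub>p r))" by (simp add: degree_pcompose r_def N)
  have cop': "coprime p' q'" "N = max (degree p') (degree q')"
    unfolding p'_def q'_def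
    using coprime_reflect[OF coprime_pcompose[OF cop] N'] max_degree_reflect[OF coprime_pcompose[OF cop] N']
    by simp_all
  have m: "mult_at N (pencil p' q' c) z = mult_at N (pencil p q c) (cp1_shift u (cp1_inverse z))" for c z
  proof -
    have "degree (pencil p q c) \<le> N" using degree_pencil_le N by simp
    then have "degree (pencil p q c \<circ>\<^sub>p r) \<le> N" by (simp add: degree_pcompose r_def)
    moreover have "pencil p q c \<circ>\<^sub>p r \<noteq> 0" using nz by (simp add: pcompose_eq_0_iff r_def)
    ultimately show ?thesis
      by (simp add: p'_def q'_def pencil_reflect pencil_pcompose mult_at_reflect)
        (simp add: r_def mult_at_shift nz)
  qed
  define g where "g z = cp1_shift u (cp1_inverse z)" for z
  have inj: "z = cp1_inverse (cp1_shift (- u) (g z))" for z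
    by (cases z) (auto simp: g_def)
  define z1' where "z1' = cp1_inverse (cp1_shift (- u) z1)"
  have gz1: "g z1' = z1" by (simp add: g_def z1'_def)
  have gI: "g Infty = z2" by (simp add: g_def Fin)
  have "z1' \<noteq> Infty" using z12 gz1 gI by auto
  then obtain t where t: "z1' = Fin t" by (cases z1') auto
  have "\<nu> c dvd a * mult_at N (pencil p' q' c) Infty"
  proof (rule ramification_two_points_infinity[OF cop' pos good a])
    show "\<nu> c dvd mult_at N (pencil p' q' c) z" if "z \<noteq> Fin t" "z \<noteq> Infty" for c z
    proof -
      have "g z \<noteq> z1" "g z \<noteq> z2" using that inj gz1 gI t by metis+
      then show ?thesis unfolding m g_def[symmetric] by (rule other)
    qed
    show "\<nu> c dvd a * mult_at N (pencil p' q' c) (Fin t)" for c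
      unfolding m g_def[symmetric] t[symmetric] gz1 by (rule zero)
  qed
  then show ?thesis unfolding m g_def[symmetric] gI .
qed

section \<open>Rational functions and orbifolds on the sphere\<close>

text \<open>In the coordinate at the value \<open>c\<close>, the map is the member over
  \<open>c\<close> divided by \<open>q\<close>, or by \<open>p\<close> when \<open>c\<close> is
  infinity; the denominator does not vanish at 0, so the order is that of the member.\<close>

lemma zorder_ratio_map:
  assumes cop: "coprime p q" and c: "c = ratio_map p q (Fin 0)" and nz: "pencil p q c \<noteq> 0"
  shows "zorder (\<lambda>w. coord_at c (ratio_map p q (Fin w))) 0 = int (order 0 (pencil p q c))"
proof -
  define m where "m = order 0 (pencil p q c)"
  obtain Q where Q: "pencil p q c = [:- 0, 1:] ^ m * Q" "\<not> [:- 0, 1:] dvd Q"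
    using order_decomp[OF nz, of 0] unfolding m_def by blast
  have Q0: "poly Q 0 \<noteq> 0" using Q(2) by (metis poly_eq_0_iff_dvd)
  have pen: "poly (pencil p q c) w = poly Q w * w powi int m" for w
    by (subst Q(1)) simp
  have op: "open {w. poly r w \<noteq> 0}" for r :: "complex poly"
    by (intro open_Collect_neq continuous_intros)
  show ?thesis
  proof (cases c)
    case (Fin b)
    have q0: "poly q 0 \<noteq> 0" "b = poly p 0 / poly q 0"
      using c Fin by (auto simp: ratio_map_def split: if_splits)
    show ?thesis
      unfolding m_def[symmetric]
    proof (rule zorder_eqI[where g = "\<lambda>w. poly Q w / poly q w"])
      show "open {w. poly q w \<noteq> 0}" by (rule op)
      show "(\<lambda>w. poly Q w / poly q w) holomorphic_on {w. poly q w \<noteq> 0}"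
        by (intro holomorphic_intros) auto
      fix w assume w: "w \<in> {w. poly q w \<noteq> 0}"
      have "coord_at c (ratio_map p q (Fin w)) = poly (pencil p q c) w / poly q w"
        using w by (simp add: Fin ratio_map_def diff_divide_distrib)
      then show "coord_at c (ratio_map p q (Fin w)) = poly Q w / poly q w * (w - 0) powi int m"
        by (simp add: pen)
    qed (use q0 Q0 in auto)
  next
    case Infty
    have q0: "poly q 0 = 0" using c Infty by (auto simp: ratio_map_def split: if_splits)
    then have p0: "poly p 0 \<noteq> 0" using cop by (auto simp: coprime_iff_no_common_root)
    show ?thesis
      unfolding m_def[symmetric]
    proof (rule zorder_eqI[where g = "\<lambda>w. poly Q w / poly p w"])
      show "open {w. poly p w \<noteq> 0}" by (rule op)
      show "(\<lambda>w. poly Q w / poly p w) holomorphic_on {w. poly p w \<noteq> 0}"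
        by (intro holomorphic_intros) auto
      fix w assume w: "w \<in> {w. poly p w \<noteq> 0}"
      \<comment> \<open>Where \<open>q\<close> vanishes, the value is infinity and its coordinate 0
        still equals \<open>q / p\<close>.\<close>
      have "coord_at c (ratio_map p q (Fin w)) = poly (pencil p q c) w / poly p w"
        using w by (simp add: Infty ratio_map_def)
      then show "coord_at c (ratio_map p q (Fin w)) = poly Q w / poly p w * (w - 0) powi int m"
        by (simp add: pen)
    qed (use p0 Q0 in auto)
  qed
qed

text \<open>In the local parameter at any point the map is again a quotient of coprime polynomials:
  translates at a finite point, reversals at infinity. Everything local can then be read off at
  0.\<close>

lemma ratio_map_param_at:
  assumes cop: "coprime p q" and N: "N = max (degree p) (degree q)" "N > 0"
  obtains p' q' where "coprime p' q'" "\<And>w. ratio_map p q (param_at z w) = ratio_map p' q' (Fin w)"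
    "\<And>c. order 0 (pencil p' q' c) = mult_at N (pencil p q c) z" "\<And>c. pencil p' q' c \<noteq> 0"
proof (cases z)
  case (Fin a)
  have nz: "pencil p q c \<noteq> 0" for c using pencil_nonzero[OF cop] N by simp
  show ?thesis
  proof (rule that)
    show "coprime (p \<circ>\<^sub>p [:a, 1:]) (q \<circ>\<^sub>p [:a, 1:])" by (rule coprime_pcompose[OF cop])
    show "ratio_map p q (param_at z w) = ratio_map (p \<circ>\<^sub>p [:a, 1:]) (q \<circ>\<^sub>p [:a, 1:]) (Fin w)" for w
      by (simp add: Fin ratio_map_def poly_pcompose)
    show "order 0 (pencil (p \<circ>\<^sub>p [:a, 1:]) (q \<circ>\<^sub>p [:a, 1:]) c) = mult_at N (pencil p q c) z" for c
      using mult_at_shift[OF nz[of c], of N a "Fin 0"] by (simp add: Fin pencil_pcompose)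
    show "pencil (p \<circ>\<^sub>p [:a, 1:]) (q \<circ>\<^sub>p [:a, 1:]) c \<noteq> 0" for c
      using nz by (simp add: pencil_pcompose pcompose_eq_0_iff)
  qed
next
  case Infty
  have nz: "pencil p q c \<noteq> 0" for c using pencil_nonzero[OF cop] N by simp
  have le: "degree (pencil p q c) \<le> N" for c using degree_pencil_le N by simp
  show ?thesis
  proof (rule that)
    show "coprime (reflect N p) (reflect N q)" by (rule coprime_reflect[OF cop N(1)])
    show "ratio_map p q (param_at z w) = ratio_map (reflect N p) (reflect N q) (Fin w)" for w
    proof (cases "w = 0")
      case True
      show ?thesis
      proof (cases "degree q < degree p")
        case True
        then show ?thesis using \<open>w = 0\<close> N by (simp add: Infty ratio_map_def poly_reflect_0 coeff_eq_0)
      next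
        case False
        then have "N = degree q" using N by simp
        moreover from this have "q \<noteq> 0" using N by auto
        ultimately show ?thesis using \<open>w = 0\<close> False by (simp add: Infty ratio_map_def poly_reflect_0)
      qed
    next
      case False
      then show ?thesis using N by (simp add: Infty ratio_map_def poly_reflect)
    qed
    show "order 0 (pencil (reflect N p) (reflect N q) c) = mult_at N (pencil p q c) z" for c
      by (simp add: Infty pencil_reflect order_0_reflect nz le)
    show "pencil (reflect N p) (reflect N q) c \<noteq> 0" for c
      by (simp add: pencil_reflect reflect_eq_0_iff nz le)
  qed
qed

lemma param_at_0 [simp]: "param_at z 0 = z"
  by (cases z) auto

lemma ratio_map_0_iff:
  assumes "coprime p q"
  shows "ratio_map p q (Fin 0) = c \<longleftrightarrow> poly (pencil p q c) 0 = 0"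
  using assms by (cases c) (auto simp: ratio_map_def coprime_iff_no_common_root divide_simps)

lemma
  assumes cop: "coprime p q" and N: "N = max (degree p) (degree q)" "N > 0"
  shows local_degree_ratio_map:
      "local_degree (ratio_map p q) z = mult_at N (pencil p q (ratio_map p q z)) z"
    and mult_at_pencil_pos_iff: "mult_at N (pencil p q c) z > 0 \<longleftrightarrow> ratio_map p q z = c"
proof -
  obtain p' q' where pq: "coprime p' q'" "\<And>w. ratio_map p q (param_at z w) = ratio_map p' q' (Fin w)"
    "\<And>c. order 0 (pencil p' q' c) = mult_at N (pencil p q c) z" "\<And>c. pencil p' q' c \<noteq> 0"
    by (rule ratio_map_param_at[OF cop N, of z]) (blast intro: that)
  have z: "ratio_map p q z = ratio_map p' q' (Fin 0)" using pq(2)[of 0] by simp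
  show "local_degree (ratio_map p q) z = mult_at N (pencil p q (ratio_map p q z)) z"
    unfolding local_degree_def pq(2) zorder_ratio_map[OF pq(1) z pq(4)] pq(3) by simp
  show "mult_at N (pencil p q c) z > 0 \<longleftrightarrow> ratio_map p q z = c"
    unfolding z ratio_map_0_iff[OF pq(1)] pq(3)[symmetric] using pq(4) by (rule order_gt_0_iff)
qed

lemma finite_ratio_map_fiber:
  assumes cop: "coprime p q" and N: "N = max (degree p) (degree q)" "N > 0"
  shows "finite {z. ratio_map p q z = c}"
proof -
  have "{z. ratio_map p q z = c} \<subseteq> insert Infty (Fin ` {w. poly (pencil p q c) w = 0})"
  proof
    fix z assume "z \<in> {z. ratio_map p q z = c}"
    then have "mult_at N (pencil p q c) z > 0" using mult_at_pencil_pos_iff[OF cop N] by simp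
    then show "z \<in> insert Infty (Fin ` {w. poly (pencil p q c) w = 0})"
      using pencil_nonzero[OF cop] N by (cases z) (auto simp: order_gt_0_iff)
  qed
  moreover have "finite {w. poly (pencil p q c) w = 0}"
    using pencil_nonzero[OF cop] N by (intro poly_roots_finite) auto
  ultimately show ?thesis using finite_subset by blast
qed

section \<open>Sparse sets on the sphere\<close>

instance cp1 :: t1_space
proof
  fix x y :: cp1 assume "x \<noteq> y"
  have "open (- {y})"
  proof (cases y)
    case (Fin b)
    have "Fin -` (- {y}) = - {b}" by (auto simp: Fin)
    then show ?thesis by (simp add: open_cp1_def open_Compl Fin)
  next
    case Infty
    have "Fin -` (- {y}) = UNIV" by (auto simp: Infty)
    then show ?thesis by (simp add: open_cp1_def Infty)
  qed
  then show "\<exists>U. open U \<and> x \<in> U \<and> y \<notin> U" using \<open>x \<noteq> y\<close> by blast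
qed

lemma compact_cp1: "compact (UNIV :: cp1 set)"
proof (rule compactI)
  fix C :: "cp1 set set" assume C: "\<forall>B\<in>C. open B" "UNIV \<subseteq> \<Union>C"
  then obtain U where U: "U \<in> C" "Infty \<in> U" by blast
  then have "compact (- (Fin -` U))" using C by (auto simp: open_cp1_def)
  moreover have "- (Fin -` U) \<subseteq> (\<Union>B\<in>C. Fin -` B)"
  proof
    fix w
    show "w \<in> (\<Union>B\<in>C. Fin -` B)" using subsetD[OF C(2), of "Fin w"] by auto
  qed
  moreover have "open (Fin -` B)" if "B \<in> C" for B using C that by (auto simp: open_cp1_def)
  ultimately obtain D where D: "D \<subseteq> C" "finite D" "- (Fin -` U) \<subseteq> (\<Union>B\<in>D. Fin -` B)"
    by (metis compactE_image)
  have "UNIV \<subseteq> \<Union>(insert U D)"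
  proof
    fix z :: cp1
    show "z \<in> \<Union>(insert U D)" using D(3) U(2) by (cases z) auto
  qed
  then show "\<exists>C'\<subseteq>C. finite C' \<and> UNIV \<subseteq> \<Union>C'"
    using D U by (intro exI[of _ "insert U D"]) auto
qed

text \<open>On a compact space every infinite set has a limit point.\<close>

lemma sparse_in_cp1_iff_finite: "S sparse_in (UNIV :: cp1 set) \<longleftrightarrow> finite S"
proof
  assume "S sparse_in (UNIV :: cp1 set)"
  then have no: "\<not> x islimpt S" for x by (simp add: sparse_in_open)
  show "finite S"
    using Heine_Borel_imp_Bolzano_Weierstrass[OF compact_cp1, of S] no by blast
qed (rule finite_imp_sparse)

text \<open>Brings both kinds of badness to one form. With a single weighted point, any other point
  serves as \<open>z1\<close>, with weight 1; with two, unequal weights cannot divide each other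
  both ways, so one order of the points works.\<close>

lemma bad_cases:
  assumes "bad \<nu>" "\<And>z. \<nu> z \<ge> 1"
  obtains z1 z2 where "z1 \<noteq> z2" "\<And>z. z \<noteq> z1 \<Longrightarrow> z \<noteq> z2 \<Longrightarrow> \<nu> z = 1" "\<not> \<nu> z2 dvd \<nu> z1"
  using assms(1) unfolding bad_def
proof (elim disjE exE conjE)
  fix z assume z: "{x. \<nu> x > 1} = {z}"
  then have one: "\<nu> x = 1" if "x \<noteq> z" for x
    using that assms(2)[of x] by (metis mem_Collect_eq order_le_less singletonD)
  obtain z1 where "z1 \<noteq> z" by (metis cp1.distinct(1))
  moreover have "\<nu> z > 1" using z by blast
  ultimately show thesis using one by (intro that[of z1 z]) auto
next
  fix z1 z2 assume z: "z1 \<noteq> z2" "{x. \<nu> x > 1} = {z1, z2}" "\<nu> z1 \<noteq> \<nu> z2"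
  then have one: "\<nu> x = 1" if "x \<noteq> z1" "x \<noteq> z2" for x
    using that assms(2)[of x] by (metis insertE mem_Collect_eq order_le_less singletonD)
  have "\<not> \<nu> z2 dvd \<nu> z1 \<or> \<not> \<nu> z1 dvd \<nu> z2" using z(3) dvd_antisym by blast
  then show thesis using that[of z1 z2] that[of z2 z1] z(1) one by metis
qed

text \<open>Characterises the pullback weight without the quotient: it is the least positive
  \<open>a\<close> for which \<open>n\<close> divides \<open>a * d\<close>.\<close>

lemma div_gcd_dvd_iff:
  fixes n d a :: nat
  assumes "n > 0"
  shows "n div gcd d n dvd a \<longleftrightarrow> n dvd a * d"
proof -
  have g: "gcd d n > 0" using assms by simp
  then obtain d' n' where dn: "d = d' * gcd d n" "n = n' * gcd d n" "coprime d' n'"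
    using gcd_coprime_exists[of d n] by auto
  have "n dvd a * d \<longleftrightarrow> n' * gcd d n dvd (a * d') * gcd d n"
    using dn(1,2) by (metis mult.assoc)
  also have "\<dots> \<longleftrightarrow> n' dvd a" using g dn(3) by (simp add: coprime_dvd_mult_left_iff coprime_commute)
  also have "n' = n div gcd d n" using dn(2) g by (metis div_mult_self_is_m)
  finally show ?thesis by simp
qed

theorem theorem1p2:
  fixes f :: "cp1 \<Rightarrow> cp1" and \<nu> :: "cp1 \<Rightarrow> nat"
  assumes "rational_function f"
    and "good_orbifold \<nu>"
  shows "good_orbifold (pullback f \<nu>)"
proof -
  obtain p q where pq: "q \<noteq> 0" "coprime p q" "f = ratio_map p q" and nc: "\<not> f constant_on UNIV"
    using assms(1) by (auto simp: rational_function_def)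
  define N where "N = max (degree p) (degree q)"
  have "N > 0"
  proof (rule ccontr)
    assume "\<not> N > 0"
    then obtain a b where "p = [:a:]" "q = [:b:]" by (auto simp: N_def elim!: degree_eq_zeroE)
    then have "f z = Fin (a / b)" for z
      using pq by (cases z) (auto simp: ratio_map_def)
    then show False using nc by (auto simp: constant_on_def)
  qed
  have \<nu>: "\<nu> c \<ge> 1" "finite {z. \<nu> z \<noteq> 1}" "\<not> bad \<nu>" for c
    using assms(2) by (auto simp: good_orbifold_def orbifold_def sparse_in_cp1_iff_finite)
  define d where "d z = mult_at N (pencil p q (f z)) z" for z
  have pb: "pullback f \<nu> z = \<nu> (f z) div gcd (d z) (\<nu> (f z))" for z
    using local_degree_ratio_map[OF pq(2) N_def \<open>N > 0\<close>] by (simp add: pullback_def d_def pq(3))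
  have pb_dvd: "pullback f \<nu> z dvd a \<longleftrightarrow> \<nu> (f z) dvd a * d z" for z a
    using div_gcd_dvd_iff[of "\<nu> (f z)" "d z" a] \<nu>(1)[of "f z"] by (simp add: pb)
  \<comment> \<open>For \<open>c\<close> other than \<open>f z\<close> the multiplicity is 0, so a
    condition at the value extends to all members of the pencil.\<close>
  have mult: "\<nu> (f z) dvd k * d z \<Longrightarrow> \<nu> c dvd k * mult_at N (pencil p q c) z" for c k z
    using mult_at_pencil_pos_iff[OF pq(2) N_def \<open>N > 0\<close>, of c z] by (cases "f z = c") (auto simp: d_def pq(3))
  have pb_pos: "pullback f \<nu> z \<ge> 1" for z
    unfolding pb using \<nu>(1)[of "f z"] by (simp add: Suc_le_eq div_greater_zero_iff gcd_le2_nat)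
  have "{z. pullback f \<nu> z \<noteq> 1} \<subseteq> (\<Union>c\<in>{c. \<nu> c \<noteq> 1}. {z. f z = c})"
    by (auto simp: pb)
  moreover have "finite (\<Union>c\<in>{c. \<nu> c \<noteq> 1}. {z. f z = c})"
    using \<nu>(2) finite_ratio_map_fiber[OF pq(2) N_def \<open>N > 0\<close>] by (simp add: pq(3))
  ultimately have "finite {z. pullback f \<nu> z \<noteq> 1}" by (rule finite_subset)
  moreover have "\<not> bad (pullback f \<nu>)"
  proof
    assume "bad (pullback f \<nu>)"
    then obtain z1 z2 where z: "z1 \<noteq> z2" "\<And>z. z \<noteq> z1 \<Longrightarrow> z \<noteq> z2 \<Longrightarrow> pullback f \<nu> z = 1"
        "\<not> pullback f \<nu> z2 dvd pullback f \<nu> z1"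
      by (rule bad_cases[OF _ pb_pos]) (blast intro: that)
    \<comment> \<open>The weight at \<open>z1\<close> is the exponent of the power map: by
      \<open>pb_dvd\<close> it makes the multiplicities over \<open>z1\<close> divisible, and the
      conclusion at \<open>z2\<close> then reads that the weight at \<open>z2\<close> divides
      it.\<close>
    define a where "a = pullback f \<nu> z1"
    have "\<nu> (f z2) dvd a * d z2"
      unfolding d_def
    proof (rule ramification_two_points[OF pq(2) N_def \<open>N > 0\<close> \<nu>(1) \<nu>(3) _ z(1)])
      show "a \<ge> 1" using pb_pos by (simp add: a_def)
      show "\<nu> c dvd mult_at N (pencil p q c) z" if "z \<noteq> z1" "z \<noteq> z2" for c z
      proof -
        have "\<nu> (f z) dvd 1 * d z" using z(2)[OF that] pb_dvd[of z 1] by simp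
        from mult[OF this] show ?thesis by simp
      qed
      show "\<nu> c dvd a * mult_at N (pencil p q c) z1" for c
        by (intro mult) (simp add: a_def flip: pb_dvd)
    qed
    then have "pullback f \<nu> z2 dvd a" by (simp add: pb_dvd)
    then show False using z(3) by (simp add: a_def)
  qed
  ultimately show ?thesis
    using pb_pos by (simp add: good_orbifold_def orbifold_def sparse_in_cp1_iff_finite)
qed

end
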